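(* Let $\Pi$ be a group and let $A$ be a cancellative $\Pi$-semimodule. If $H^3(\Pi,A)=0$, then for any group homomorphism $\phi:\Pi\to \mathrm{Aut}(S)/\mathrm{In}(S)$ with $S$ an Ore monoid and with centre $A$, the abstract kernel $(\Pi,\,-S+S,\,\Phi_S\phi)$ has an extension.
   Context: A $\Pi$-semimodule is an abelian monoid $(A,+,0)$ with a left action of $\Pi$ by monoid endomorphisms: $x(a+a')=xa+xa'$, $x0=0$, $(xy)a=x(ya)$, $1a=a$. It is cancellative if $a+a'=a+a''$ implies $a'=a''$. **Cohomology monoid $H^3(\Pi,A)$.** A $3$-cocycle is a function $f:\Pi^3\to A$ which vanishes whenever one of its arguments is $1$ and satisfies $$x_1f(x_2,x_3,x_4)+f(x_1,x_2x_3,x_4)+f(x_1,x_2,x_3)=f(x_1x_2,x_3,x_4)+f(x_1,x_2,x_3x_4)$$ for all $x_i\in\Pi$. Two $3$-cocycles $f,f'$ are identified if there are functions $g_1,g_2:\Pi^2\to A$, vanishing whenever one of their arguments is $1$, such that for all $x,y,z\in\Pi$ $$f(x,y,z)+g_1(xy,z)+g_1(x,y)+xg_2(y,z)+g_2(x,yz)=f'(x,y,z)+g_2(xy,z)+g_2(x,y)+xg_1(y,z)+g_1(x,yz).$$ $H^3(\Pi,A)$ is the resulting quotient monoid of the abelian monoid of $3$-cocycles (under pointwise addition). $H^3(\Pi,A)=0$ means that it has exactly one element. **Inner automorphisms of monoids.** Let $S$ be an additively written, not necessarily abelian, monoid. Each invertible $u\in S$ gives an inner automorphism $\mu_u(s)=u+s-u$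 of $S$. These form a normal subgroup $\mathrm{In}(S)$ of the automorphism group $\mathrm{Aut}(S)$. Given a group homomorphism $\phi:\Pi\to\mathrm{Aut}(S)/\mathrm{In}(S)$, the centre of the monoid $S$ becomes a $\Pi$-semimodule by $xa=\varphi(x)(a)$ for any choice of $\varphi(x)\in\phi(x)$; this $\Pi$-semimodule is called the centre of $\phi$. **Ore monoids.** An Ore monoid is a (two-sided) cancellative monoid $S$ with $(S+s)\cap(S+t)\ne\emptyset$ for all $s,t\in S$. Equivalently, $S$ has a group of left fractions, denoted $-S+S$: a group containing $S$ as a submonoid, each of whose elements has the form $-s_1+s_2$ with $s_1,s_2\in S$. Each $\varphi\in\mathrm{Aut}(S)$ extends to $\widetilde\varphi\in\mathrm{Aut}(-S+S)$, $\widetilde\varphi(-s_1+s_2)=-\varphi(s_1)+\varphi(s_2)$, and $\Phi_S:\mathrm{Aut}(S)/\mathrm{In}(S)\to\mathrm{Aut}(-S+S)/\mathrm{In}(-S+S)$, $\Phi_S(cl\,\varphi)=cl\,\widetilde\varphi$, is a group homomorphism. **Abstract kernels.** An abstract kernel is a triple $(\Pi,G,\psi)$ with $\Pi,G$ groups and $\psi:\Pi\to\mathrm{Aut}(G)/\mathrm{In}(G)$ a group homomorphism. A group extension $1\to G\to B\to\Pi\to1$ induces, by conjugation in $B$, a homomorphism $\Pi\to\mathrm{Aut}(G)/\mathrm{In}(G)$. The abstract kernel $(\Pi,G,\psi)$ has an extension if there is such a group extension whose induced homomorphism is $\psi$. *)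

theory Defs
  imports "HOL-Algebra.Divisibility" "HOL-Algebra.Weak_Morphisms" "HOL-Algebra.Bij"
begin

text \<open>
  All monoids are written multiplicatively, in the notation of HOL-Algebra, including those
  that are additive in the literature: the semimodule \<open>A\<close> and the monoid \<open>S\<close> below.
\<close>

section \<open>Semimodules\<close>

locale Pi_semimodule = P?: group P + A?: comm_monoid A
  for P :: "('p, 'm) monoid_scheme" and A :: "('a, 'n) monoid_scheme"
    and act :: "'p \<Rightarrow> 'a \<Rightarrow> 'a" +
  assumes act_closed: "\<lbrakk>x \<in> carrier P; a \<in> carrier A\<rbrakk> \<Longrightarrow> act x a \<in> carrier A"
    and act_add: "\<lbrakk>x \<in> carrier P; a \<in> carrier A; b \<in> carrier A\<rbrakk>
      \<Longrightarrow> act x (a \<otimes>\<^bsub>A\<^esub> b) = act x a \<otimes>\<^bsub>A\<^esub> act x b"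
    and act_zero: "x \<in> carrier P \<Longrightarrow> act x \<one>\<^bsub>A\<^esub> = \<one>\<^bsub>A\<^esub>"
    and act_assoc: "\<lbrakk>x \<in> carrier P; y \<in> carrier P; a \<in> carrier A\<rbrakk>
      \<Longrightarrow> act (x \<otimes>\<^bsub>P\<^esub> y) a = act x (act y a)"
    and act_one: "a \<in> carrier A \<Longrightarrow> act \<one>\<^bsub>P\<^esub> a = a"

definition semimodules_isomorphic ::
  "('p, 'm) monoid_scheme \<Rightarrow> ('a, 'n) monoid_scheme \<Rightarrow> ('p \<Rightarrow> 'a \<Rightarrow> 'a)
    \<Rightarrow> ('b, 'k) monoid_scheme \<Rightarrow> ('p \<Rightarrow> 'b \<Rightarrow> 'b) \<Rightarrow> bool" where
  "semimodules_isomorphic P A act B act' \<longleftrightarrow>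
    (\<exists>h \<in> iso A B. \<forall>x \<in> carrier P. \<forall>a \<in> carrier A. h (act x a) = act' x (h a))"


section \<open>The third cohomology monoid\<close>

definition cochains2 :: "('p, 'm) monoid_scheme \<Rightarrow> ('a, 'n) monoid_scheme \<Rightarrow> ('p \<times> 'p \<Rightarrow> 'a) set" where
  "cochains2 P A = {g \<in> carrier P \<times> carrier P \<rightarrow>\<^sub>E carrier A.
    \<forall>x \<in> carrier P. g (\<one>\<^bsub>P\<^esub>, x) = \<one>\<^bsub>A\<^esub> \<and> g (x, \<one>\<^bsub>P\<^esub>) = \<one>\<^bsub>A\<^esub>}"

definition cocycles3 ::
  "('p, 'm) monoid_scheme \<Rightarrow> ('a, 'n) monoid_scheme \<Rightarrow> ('p \<Rightarrow> 'a \<Rightarrow> 'a) \<Rightarrow> ('p \<times> 'p \<times> 'p \<Rightarrow> 'a) set" where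
  "cocycles3 P A act = {f \<in> carrier P \<times> carrier P \<times> carrier P \<rightarrow>\<^sub>E carrier A.
    (\<forall>x \<in> carrier P. \<forall>y \<in> carrier P.
      f (\<one>\<^bsub>P\<^esub>, x, y) = \<one>\<^bsub>A\<^esub> \<and> f (x, \<one>\<^bsub>P\<^esub>, y) = \<one>\<^bsub>A\<^esub> \<and> f (x, y, \<one>\<^bsub>P\<^esub>) = \<one>\<^bsub>A\<^esub>) \<and>
    (\<forall>x1 \<in> carrier P. \<forall>x2 \<in> carrier P. \<forall>x3 \<in> carrier P. \<forall>x4 \<in> carrier P.
      act x1 (f (x2, x3, x4)) \<otimes>\<^bsub>A\<^esub> f (x1, x2 \<otimes>\<^bsub>P\<^esub> x3, x4) \<otimes>\<^bsub>A\<^esub> f (x1, x2, x3)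
      = f (x1 \<otimes>\<^bsub>P\<^esub> x2, x3, x4) \<otimes>\<^bsub>A\<^esub> f (x1, x2, x3 \<otimes>\<^bsub>P\<^esub> x4))}"

definition cohomologous3 ::
  "('p, 'm) monoid_scheme \<Rightarrow> ('a, 'n) monoid_scheme \<Rightarrow> ('p \<Rightarrow> 'a \<Rightarrow> 'a)
    \<Rightarrow> (('p \<times> 'p \<times> 'p \<Rightarrow> 'a) \<times> ('p \<times> 'p \<times> 'p \<Rightarrow> 'a)) set" where
  "cohomologous3 P A act = {(f, f') \<in> cocycles3 P A act \<times> cocycles3 P A act.
    \<exists>g1 \<in> cochains2 P A. \<exists>g2 \<in> cochains2 P A.
      \<forall>x \<in> carrier P. \<forall>y \<in> carrier P. \<forall>z \<in> carrier P.
        f (x, y, z) \<otimes>\<^bsub>A\<^esub> g1 (x \<otimes>\<^bsub>P\<^esub> y, z) \<otimes>\<^bsub>A\<^esub> g1 (x, y)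
          \<otimes>\<^bsub>A\<^esub> act x (g2 (y, z)) \<otimes>\<^bsub>A\<^esub> g2 (x, y \<otimes>\<^bsub>P\<^esub> z)
        = f' (x, y, z) \<otimes>\<^bsub>A\<^esub> g2 (x \<otimes>\<^bsub>P\<^esub> y, z) \<otimes>\<^bsub>A\<^esub> g2 (x, y)
          \<otimes>\<^bsub>A\<^esub> act x (g1 (y, z)) \<otimes>\<^bsub>A\<^esub> g1 (x, y \<otimes>\<^bsub>P\<^esub> z)}"

definition add_cochains3 ::
  "('p, 'm) monoid_scheme \<Rightarrow> ('a, 'n) monoid_scheme
    \<Rightarrow> ('p \<times> 'p \<times> 'p \<Rightarrow> 'a) \<Rightarrow> ('p \<times> 'p \<times> 'p \<Rightarrow> 'a) \<Rightarrow> ('p \<times> 'p \<times> 'p \<Rightarrow> 'a)" where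
  "add_cochains3 P A f f' = (\<lambda>t \<in> carrier P \<times> carrier P \<times> carrier P. f t \<otimes>\<^bsub>A\<^esub> f' t)"

definition zero_cochain3 ::
  "('p, 'm) monoid_scheme \<Rightarrow> ('a, 'n) monoid_scheme \<Rightarrow> ('p \<times> 'p \<times> 'p \<Rightarrow> 'a)" where
  "zero_cochain3 P A = (\<lambda>t \<in> carrier P \<times> carrier P \<times> carrier P. \<one>\<^bsub>A\<^esub>)"

definition H3 ::
  "('p, 'm) monoid_scheme \<Rightarrow> ('a, 'n) monoid_scheme \<Rightarrow> ('p \<Rightarrow> 'a \<Rightarrow> 'a)
    \<Rightarrow> ('p \<times> 'p \<times> 'p \<Rightarrow> 'a) set monoid" where
  "H3 P A act =
    \<lparr>carrier = cocycles3 P A act // cohomologous3 P A act,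
     monoid.mult = (\<lambda>C C'. \<Union>f \<in> C. \<Union>f' \<in> C'. cohomologous3 P A act `` {add_cochains3 P A f f'}),
     one = cohomologous3 P A act `` {zero_cochain3 P A}\<rparr>"


section \<open>Automorphisms of monoids modulo inner automorphisms\<close>

definition inner_aut :: "('s, 'm) monoid_scheme \<Rightarrow> 's \<Rightarrow> 's \<Rightarrow> 's" where
  "inner_aut S u = (\<lambda>s \<in> carrier S. u \<otimes>\<^bsub>S\<^esub> s \<otimes>\<^bsub>S\<^esub> inv\<^bsub>S\<^esub> u)"

definition inner_auts :: "('s, 'm) monoid_scheme \<Rightarrow> ('s \<Rightarrow> 's) set" where
  "inner_auts S = inner_aut S ` Units S"

text \<open>
  \<^term>\<open>AutoGroup S\<close> is the automorphism group also when \<open>S\<close> is only a monoid, since a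
  bijective multiplicative map preserves the neutral element.
\<close>

lemma carrier_AutoGroup: "carrier (AutoGroup S) = auto S"
  by (simp add: AutoGroup_def)

lemma mult_AutoGroup:
  "f \<in> auto S \<Longrightarrow> g \<in> auto S \<Longrightarrow> f \<otimes>\<^bsub>AutoGroup S\<^esub> g = compose (carrier S) f g"
  by (simp add: AutoGroup_def BijGroup_def auto_def)

lemma one_AutoGroup: "\<one>\<^bsub>AutoGroup S\<^esub> = (\<lambda>x \<in> carrier S. x)"
  by (simp add: AutoGroup_def BijGroup_def)

context monoid
begin

lemma AutoGroup_group: "group (AutoGroup G)"
proof (rule groupI)
  let ?A = "AutoGroup G"
  show "x \<otimes>\<^bsub>?A\<^esub> y \<in> carrier ?A" if "x \<in> carrier ?A" "y \<in> carrier ?A" for x y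
  proof -
    have "compose (carrier G) x y \<in> Bij (carrier G)"
      using that by (simp add: carrier_AutoGroup auto_def compose_Bij)
    moreover have "compose (carrier G) x y \<in> hom G G"
      using that by (auto simp: carrier_AutoGroup auto_def hom_def compose_def Pi_def)
    ultimately show ?thesis
      using that by (simp add: carrier_AutoGroup mult_AutoGroup) (simp add: auto_def)
  qed
  show "\<one>\<^bsub>?A\<^esub> \<in> carrier ?A"
    by (auto simp: carrier_AutoGroup one_AutoGroup auto_def id_Bij hom_def)
  show "x \<otimes>\<^bsub>?A\<^esub> y \<otimes>\<^bsub>?A\<^esub> z = x \<otimes>\<^bsub>?A\<^esub> (y \<otimes>\<^bsub>?A\<^esub> z)"
    if "x \<in> carrier ?A" "y \<in> carrier ?A" "z \<in> carrier ?A" for x y z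
  proof -
    interpret B: group "BijGroup (carrier G)" by (rule group_BijGroup)
    have "x \<in> carrier (BijGroup (carrier G))" "y \<in> carrier (BijGroup (carrier G))"
      "z \<in> carrier (BijGroup (carrier G))"
      using that by (auto simp: AutoGroup_def BijGroup_def auto_def)
    from B.m_assoc[OF this] show ?thesis by (simp add: AutoGroup_def)
  qed
  show "\<one>\<^bsub>?A\<^esub> \<otimes>\<^bsub>?A\<^esub> x = x" if "x \<in> carrier ?A" for x
  proof -
    interpret B: group "BijGroup (carrier G)" by (rule group_BijGroup)
    have "x \<in> carrier (BijGroup (carrier G))"
      using that by (auto simp: AutoGroup_def BijGroup_def auto_def)
    from B.l_one[OF this] show ?thesis by (simp add: AutoGroup_def)
  qed
  show "\<exists>y \<in> carrier ?A. y \<otimes>\<^bsub>?A\<^esub> x = \<one>\<^bsub>?A\<^esub>" if "x \<in> carrier ?A" for x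
  proof -
    have x: "x \<in> Bij (carrier G)" "x \<in> hom G G"
      using that by (auto simp: carrier_AutoGroup auto_def)
    let ?y = "restrict (inv_into (carrier G) x) (carrier G)"
    have "?y \<in> hom G G"
      unfolding hom_def
      using x by (auto simp: Bij_inv_into_mem hom_mult
          intro!: Bij_inv_into_lemma[where h = x and g = "mult G"])
    then have "?y \<in> auto G"
      using x by (simp add: auto_def restrict_inv_into_Bij)
    moreover from this have "?y \<otimes>\<^bsub>?A\<^esub> x = \<one>\<^bsub>?A\<^esub>"
      using that x
      by (simp add: mult_AutoGroup carrier_AutoGroup one_AutoGroup Bij_compose_restrict_eq)
    ultimately show ?thesis by (auto simp: carrier_AutoGroup)
  qed
qed

lemma inner_aut_apply: "s \<in> carrier G \<Longrightarrow> inner_aut G u s = u \<otimes> s \<otimes> inv u"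
  by (simp add: inner_aut_def)

lemma Units_cancel_mid:
  assumes "u \<in> Units G" "s \<in> carrier G" "t \<in> carrier G"
  shows "s \<otimes> inv u \<otimes> (u \<otimes> t) = s \<otimes> t"
  using assms by (metis Units_closed Units_inv_closed Units_l_inv l_one m_assoc m_closed)

lemma inner_aut_mult:
  assumes "u \<in> Units G" "v \<in> Units G"
  shows "compose (carrier G) (inner_aut G u) (inner_aut G v) = inner_aut G (u \<otimes> v)"
proof
  fix s
  have "inv (u \<otimes> v) = inv v \<otimes> inv u"
  proof (rule inv_unique'[symmetric])
    show "u \<otimes> v \<otimes> (inv v \<otimes> inv u) = \<one>"
      using assms Units_cancel_mid[of "inv v" u "inv u"] by (simp add: Units_closed)
    show "inv v \<otimes> inv u \<otimes> (u \<otimes> v) = \<one>"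
      using assms by (simp add: Units_cancel_mid Units_closed)
  qed (use assms in \<open>auto simp: Units_closed\<close>)
  then show "compose (carrier G) (inner_aut G u) (inner_aut G v) s = inner_aut G (u \<otimes> v) s"
    using assms by (auto simp: compose_def inner_aut_def m_assoc Units_closed)
qed

lemma inner_aut_one: "inner_aut G \<one> = (\<lambda>x \<in> carrier G. x)"
  by (auto simp: inner_aut_def)

lemma inner_aut_auto:
  assumes u: "u \<in> Units G"
  shows "inner_aut G u \<in> auto G"
proof -
  have "inner_aut G u \<in> hom G G"
    using u Units_cancel_mid[OF u]
    by (auto simp: hom_def inner_aut_def Units_closed m_assoc) 
  moreover have "bij_betw (inner_aut G u) (carrier G) (carrier G)"
  proof (rule bij_betw_byWitness[where f' = "inner_aut G (inv u)"])
    show "\<forall>a \<in> carrier G. inner_aut G (inv u) (inner_aut G u a) = a"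
      using inner_aut_mult[OF Units_inv_Units[OF u] u] u
      by (metis compose_eq inner_aut_one Units_l_inv restrict_apply')
    show "\<forall>a \<in> carrier G. inner_aut G u (inner_aut G (inv u) a) = a"
      using inner_aut_mult[OF u Units_inv_Units[OF u]] u
      by (metis compose_eq inner_aut_one Units_r_inv restrict_apply')
  qed (use u in \<open>auto simp: inner_aut_def Units_closed\<close>)
  ultimately show ?thesis
    by (auto simp: auto_def Bij_def inner_aut_def)
qed

lemma auto_Units:
  assumes "f \<in> auto G" "u \<in> Units G"
  shows "f u \<in> Units G" "f (inv u) = inv (f u)"
proof -
  have h: "f \<in> hom G G" and im: "f ` carrier G = carrier G"
    using assms by (auto simp: auto_def Bij_def bij_betw_def)
  have fone: "f \<one> = \<one>"
  proof -
    have "\<one> \<in> f ` carrier G" using im by simp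
    then obtain e where e: "e \<in> carrier G" "f e = \<one>" by auto
    have "f \<one> \<otimes> f e = f e" using e hom_mult[OF h one_closed e(1)] by simp
    then show ?thesis unfolding e(2) using hom_in_carrier[OF h one_closed] by simp
  qed
  have 1: "f u \<otimes> f (inv u) = \<one>" "f (inv u) \<otimes> f u = \<one>"
    using assms fone by (simp_all add: Units_closed Units_r_inv Units_l_inv flip: hom_mult[OF h])
  have 2: "f u \<in> carrier G" "f (inv u) \<in> carrier G"
    using assms by (simp_all add: hom_in_carrier[OF h] Units_closed)
  show "f u \<in> Units G" using 1 2 by (auto simp: Units_def)
  show "f (inv u) = inv (f u)" using inv_unique'[OF 2] 1 by simp
qed

lemma inner_auts_normal: "inner_auts G \<lhd> AutoGroup G"
proof -
  interpret Aut: group "AutoGroup G" by (rule AutoGroup_group)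
  have sub: "inner_auts G \<subseteq> auto G"
    using inner_aut_auto by (auto simp: inner_auts_def)
  have inv_inner: "inv\<^bsub>AutoGroup G\<^esub> (inner_aut G u) = inner_aut G (inv u)" if "u \<in> Units G" for u
    by (rule Aut.inv_equality)
      (use that in \<open>simp_all add: mult_AutoGroup carrier_AutoGroup one_AutoGroup inner_aut_auto
        inner_aut_mult inner_aut_one\<close>)
  have "subgroup (inner_auts G) (AutoGroup G)"
  proof (rule Aut.subgroupI)
    show "inner_auts G \<subseteq> carrier (AutoGroup G)" using sub by (simp add: carrier_AutoGroup)
    show "inner_auts G \<noteq> {}" by (auto simp: inner_auts_def)
    show "inv\<^bsub>AutoGroup G\<^esub> a \<in> inner_auts G" if "a \<in> inner_auts G" for a
      using that by (auto simp: inner_auts_def inv_inner)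
    show "a \<otimes>\<^bsub>AutoGroup G\<^esub> b \<in> inner_auts G" if "a \<in> inner_auts G" "b \<in> inner_auts G" for a b
      using that by (auto simp: inner_auts_def mult_AutoGroup inner_aut_auto inner_aut_mult)
  qed
  moreover have "f \<otimes>\<^bsub>AutoGroup G\<^esub> h \<otimes>\<^bsub>AutoGroup G\<^esub> inv\<^bsub>AutoGroup G\<^esub> f \<in> inner_auts G"
    if f: "f \<in> carrier (AutoGroup G)" and "h \<in> inner_auts G" for f h
  proof -
    obtain u where u: "u \<in> Units G" "h = inner_aut G u"
      using \<open>h \<in> inner_auts G\<close> by (auto simp: inner_auts_def)
    have fa: "f \<in> auto G" using f by (simp add: carrier_AutoGroup)
    then have h: "f \<in> hom G G" by (simp add: auto_def)
    have "f \<otimes>\<^bsub>AutoGroup G\<^esub> h = inner_aut G (f u) \<otimes>\<^bsub>AutoGroup G\<^esub> f"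
      using fa u h auto_Units[OF fa u(1)]
      by (auto simp: mult_AutoGroup inner_aut_auto compose_def inner_aut_apply hom_mult Units_closed
          hom_in_carrier intro!: restrict_ext)
    then have "f \<otimes>\<^bsub>AutoGroup G\<^esub> h \<otimes>\<^bsub>AutoGroup G\<^esub> inv\<^bsub>AutoGroup G\<^esub> f = inner_aut G (f u)"
      using f auto_Units(1)[OF fa u(1)] inner_aut_auto[OF auto_Units(1)[OF fa u(1)]]
        Aut.m_assoc[of "inner_aut G (f u)" f "inv\<^bsub>AutoGroup G\<^esub> f"]
      by (metis Aut.inv_closed Aut.r_inv Aut.r_one carrier_AutoGroup)
    then show ?thesis using auto_Units[OF fa u(1)] by (auto simp: inner_auts_def)
  qed
  ultimately show ?thesis by (auto simp: Aut.normal_inv_iff)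
qed

end

definition OutGroup :: "('s, 'm) monoid_scheme \<Rightarrow> ('s \<Rightarrow> 's) set monoid" where
  "OutGroup S = AutoGroup S Mod inner_auts S"

definition aut_class :: "('s, 'm) monoid_scheme \<Rightarrow> ('s \<Rightarrow> 's) \<Rightarrow> ('s \<Rightarrow> 's) set" where
  "aut_class S f = inner_auts S #>\<^bsub>AutoGroup S\<^esub> f"

definition centre :: "('s, 'm) monoid_scheme \<Rightarrow> 's set" where
  "centre S = {z \<in> carrier S. \<forall>s \<in> carrier S. z \<otimes>\<^bsub>S\<^esub> s = s \<otimes>\<^bsub>S\<^esub> z}"

definition centre_monoid :: "('s, 'm) monoid_scheme \<Rightarrow> ('s, 'm) monoid_scheme" where
  "centre_monoid S = S\<lparr>carrier := centre S\<rparr>"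

text \<open>The representative is irrelevant, because inner automorphisms fix the centre.\<close>

definition centre_act :: "('p \<Rightarrow> ('s \<Rightarrow> 's) set) \<Rightarrow> 'p \<Rightarrow> 's \<Rightarrow> 's" where
  "centre_act \<phi> x a = (SOME f. f \<in> \<phi> x) a"


section \<open>Ore monoids and groups of left fractions\<close>

locale Ore_monoid = monoid_cancel S for S :: "('s, 'm) monoid_scheme" (structure) +
  assumes ore: "\<lbrakk>s \<in> carrier S; t \<in> carrier S\<rbrakk>
    \<Longrightarrow> ((\<lambda>a. a \<otimes> s) ` carrier S) \<inter> ((\<lambda>a. a \<otimes> t) ` carrier S) \<noteq> {}"

text \<open>
  The inclusion of \<open>S\<close> into its group of left fractions is an injective monoid homomorphism \<open>i\<close>.
\<close>

definition left_fraction_group ::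
  "('s, 'm) monoid_scheme \<Rightarrow> ('g, 'n) monoid_scheme \<Rightarrow> ('s \<Rightarrow> 'g) \<Rightarrow> bool" where
  "left_fraction_group S G i \<longleftrightarrow>
    group G \<and> i \<in> mon S G \<and> i \<one>\<^bsub>S\<^esub> = \<one>\<^bsub>G\<^esub> \<and>
    (\<forall>g \<in> carrier G. \<exists>s1 \<in> carrier S. \<exists>s2 \<in> carrier S. g = inv\<^bsub>G\<^esub> (i s1) \<otimes>\<^bsub>G\<^esub> i s2)"

definition extend_aut ::
  "('s, 'm) monoid_scheme \<Rightarrow> ('g, 'n) monoid_scheme \<Rightarrow> ('s \<Rightarrow> 'g) \<Rightarrow> ('s \<Rightarrow> 's) \<Rightarrow> 'g \<Rightarrow> 'g" where
  "extend_aut S G i f = (\<lambda>g \<in> carrier G. THE h. \<exists>s1 \<in> carrier S. \<exists>s2 \<in> carrier S.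
    g = inv\<^bsub>G\<^esub> (i s1) \<otimes>\<^bsub>G\<^esub> i s2 \<and> h = inv\<^bsub>G\<^esub> (i (f s1)) \<otimes>\<^bsub>G\<^esub> i (f s2))"

text \<open>The class does not depend on the representative: composing \<open>f\<close> with the inner automorphism of
  a unit \<open>u\<close> composes its extension with the inner automorphism of \<open>i u\<close>.\<close>

definition extend_class ::
  "('s, 'm) monoid_scheme \<Rightarrow> ('g, 'n) monoid_scheme \<Rightarrow> ('s \<Rightarrow> 'g) \<Rightarrow> ('s \<Rightarrow> 's) set \<Rightarrow> ('g \<Rightarrow> 'g) set" where
  "extend_class S G i C = aut_class G (extend_aut S G i (SOME f. f \<in> C))"


section \<open>Abstract kernels and group extensions\<close>

definition group_extension ::
  "('p, 'm) monoid_scheme \<Rightarrow> ('g, 'n) monoid_scheme \<Rightarrow> ('b, 'k) monoid_scheme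
    \<Rightarrow> ('g \<Rightarrow> 'b) \<Rightarrow> ('b \<Rightarrow> 'p) \<Rightarrow> bool" where
  "group_extension P G B j p \<longleftrightarrow>
    group P \<and> group G \<and> group B \<and> j \<in> mon G B \<and> p \<in> epi B P \<and> kernel B P p = j ` carrier G"

definition conj_aut ::
  "('g, 'n) monoid_scheme \<Rightarrow> ('b, 'k) monoid_scheme \<Rightarrow> ('g \<Rightarrow> 'b) \<Rightarrow> 'b \<Rightarrow> 'g \<Rightarrow> 'g" where
  "conj_aut G B j b = (\<lambda>g \<in> carrier G. inv_into (carrier G) j (b \<otimes>\<^bsub>B\<^esub> j g \<otimes>\<^bsub>B\<^esub> inv\<^bsub>B\<^esub> b))"

definition induces ::
  "('g, 'n) monoid_scheme \<Rightarrow> ('b, 'k) monoid_scheme \<Rightarrow> ('g \<Rightarrow> 'b) \<Rightarrow> ('b \<Rightarrow> 'p)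
    \<Rightarrow> ('p \<Rightarrow> ('g \<Rightarrow> 'g) set) \<Rightarrow> bool" where
  "induces G B j p \<psi> \<longleftrightarrow> (\<forall>b \<in> carrier B. \<psi> (p b) = aut_class G (conj_aut G B j b))"

text \<open>
  The type of the middle group is no restriction: the underlying set of an extension of \<open>P\<close> by \<open>G\<close>
  is in bijection with \<^term>\<open>carrier G \<times> carrier P\<close>.
  See \<open>kernel_has_extensionI\<close> below.
\<close>

definition kernel_has_extension ::
  "('p, 'm) monoid_scheme \<Rightarrow> ('g, 'n) monoid_scheme \<Rightarrow> ('p \<Rightarrow> ('g \<Rightarrow> 'g) set) \<Rightarrow> bool" where
  "kernel_has_extension P G \<psi> \<longleftrightarrow>
    (\<exists>(B :: ('g \<times> 'p) monoid) j p. group_extension P G B j p \<and> induces G B j p \<psi>)"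

lemma kernel_has_extensionI:
  fixes P :: "('p, 'm) monoid_scheme" and G :: "('g, 'n) monoid_scheme"
    and B :: "('b, 'k) monoid_scheme"
  assumes ext: "group_extension P G B j p" and ind: "induces G B j p \<psi>"
  shows "kernel_has_extension P G \<psi>"
proof -
  interpret P: group P using ext by (simp add: group_extension_def)
  interpret G: group G using ext by (simp add: group_extension_def)
  interpret B: group B using ext by (simp add: group_extension_def)
  have j: "j \<in> hom G B" "inj_on j (carrier G)" and p: "p \<in> hom B P" "p ` carrier B = carrier P"
    and ker: "kernel B P p = j ` carrier G"
    using ext by (auto simp: group_extension_def mon_def epi_def)
  interpret p: group_hom B P p using p by unfold_locales
  define \<sigma> where "\<sigma> = inv_into (carrier B) p"
  have \<sigma>: "\<sigma> x \<in> carrier B" "p (\<sigma> x) = x" if "x \<in> carrier P" for x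
    using that p(2) by (auto simp: \<sigma>_def inv_into_into f_inv_into_f)
  define e where
    "e b = (inv_into (carrier G) j (b \<otimes>\<^bsub>B\<^esub> inv\<^bsub>B\<^esub> \<sigma> (p b)), p b)" for b
  have inj: "inj_on e (carrier B)"
  proof (rule inj_onI)
    fix b c assume b: "b \<in> carrier B" and c: "c \<in> carrier B" and "e b = e c"
    then have pe: "p b = p c" and ie: "inv_into (carrier G) j (b \<otimes>\<^bsub>B\<^esub> inv\<^bsub>B\<^esub> \<sigma> (p b))
        = inv_into (carrier G) j (c \<otimes>\<^bsub>B\<^esub> inv\<^bsub>B\<^esub> \<sigma> (p b))"
      by (auto simp: e_def)
    have "d \<otimes>\<^bsub>B\<^esub> inv\<^bsub>B\<^esub> \<sigma> (p d) \<in> j ` carrier G" if "d \<in> carrier B" for d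
      using that \<sigma> unfolding ker[symmetric] kernel_def by simp
    from this[OF b] this[OF c]
    have "b \<otimes>\<^bsub>B\<^esub> inv\<^bsub>B\<^esub> \<sigma> (p b) = c \<otimes>\<^bsub>B\<^esub> inv\<^bsub>B\<^esub> \<sigma> (p b)"
      using ie pe by (metis f_inv_into_f)
    then show "b = c" using b c \<sigma> by simp
  qed
  define C where "C = image_group e B"
  have e_iso: "e \<in> iso B C"
    using inj by (auto simp: C_def image_group_def iso_def hom_def bij_betw_def)
  have "group (C\<lparr>one := e \<one>\<^bsub>B\<^esub>\<rparr>)"
    by (rule B.iso_imp_img_group[OF e_iso])
  then have C: "group C" by (simp add: C_def image_group_def)
  have eC: "carrier C = e ` carrier B" by (simp add: C_def image_group_def)
  interpret C: group C by (rule C)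
  have e_hom: "e \<in> hom B C" using e_iso unfolding iso_def by blast
  interpret e: group_hom B C e
    by (rule group_hom.intro[OF B.is_group C]) (rule group_hom_axioms.intro[OF e_hom])
  define q where "q c = p (inv_into (carrier B) e c)" for c
  have q_e: "q (e b) = p b" if "b \<in> carrier B" for b
    using that inj by (simp add: q_def)
  have jB: "j g \<in> carrier B" if "g \<in> carrier G" for g
    using that j by (auto simp: hom_def)
  have "e \<circ> j \<in> mon G C"
  proof -
    have "e \<circ> j \<in> hom G C" using j(1) e.homh by (rule hom_compose)
    moreover have "inj_on (e \<circ> j) (carrier G)"
      using j(2) inj jB by (intro comp_inj_on inj_on_subset[OF inj]) auto
    ultimately show ?thesis by (simp add: mon_def)
  qed
  moreover have "q \<in> epi C P"
  proof -
    have "q ` carrier C = carrier P" using p(2) by (simp add: eC image_image q_e cong: image_cong)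
    moreover have "q \<in> hom C P"
      by (rule homI) (auto simp: eC q_e simp flip: e.hom_mult)
    ultimately show ?thesis by (simp add: epi_def)
  qed
  moreover have "kernel C P q = (e \<circ> j) ` carrier G"
  proof -
    have "kernel C P q = e ` kernel B P p" by (auto simp: kernel_def eC q_e)
    then show ?thesis by (simp add: ker image_comp)
  qed
  ultimately have "group_extension P G C (e \<circ> j) q"
    by (simp add: group_extension_def P.is_group G.is_group C)
  moreover have "induces G C (e \<circ> j) q \<psi>"
    unfolding induces_def
  proof
    fix c assume "c \<in> carrier C"
    then obtain b where b: "b \<in> carrier B" "c = e b" by (auto simp: eC)
    have "conj_aut G C (e \<circ> j) c = conj_aut G B j b"
    proof
      fix g
      show "conj_aut G C (e \<circ> j) c g = conj_aut G B j b g"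
      proof (cases "g \<in> carrier G")
        case True
        have "b \<otimes>\<^bsub>B\<^esub> j g \<otimes>\<^bsub>B\<^esub> inv\<^bsub>B\<^esub> b \<in> kernel B P p"
        proof -
          have "p (j g) = \<one>\<^bsub>P\<^esub>" using True ker by (auto simp: kernel_def)
          then show ?thesis using b True jB by (simp add: kernel_def)
        qed
        then obtain h where h: "h \<in> carrier G" "b \<otimes>\<^bsub>B\<^esub> j g \<otimes>\<^bsub>B\<^esub> inv\<^bsub>B\<^esub> b = j h"
          unfolding ker by auto
        have "c \<otimes>\<^bsub>C\<^esub> (e \<circ> j) g \<otimes>\<^bsub>C\<^esub> inv\<^bsub>C\<^esub> c = (e \<circ> j) h"
          using b True jB by (simp flip: h(2))
        moreover have "inj_on (e \<circ> j) (carrier G)"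
          using \<open>e \<circ> j \<in> mon G C\<close> by (simp add: mon_def)
        ultimately show ?thesis
          using True h j by (simp only: conj_aut_def restrict_apply' inv_into_f_f)
      qed (simp add: conj_aut_def)
    qed
    then show "\<psi> (q c) = aut_class G (conj_aut G C (e \<circ> j) c)"
      using ind b by (simp add: induces_def q_e)
  qed
  ultimately show ?thesis unfolding kernel_has_extension_def by blast
qed

end

theory Submission
  imports Defs
begin

text \<open>
  The theorem is the classical obstruction argument of Eilenberg and Mac Lane, run half in the monoid
  \<open>S\<close> and half in its group of left fractions \<open>G\<close>.

  Lifting the outer action to automorphisms \<open>T x\<close> of \<open>S\<close> makes it multiplicative only up to
  conjugation by units, \<open>T x (T y s) \<otimes> c x y = c x y \<otimes> T (x \<otimes>\<^bsub>P\<^esub> y) s\<close>. Both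
  \<open>T x (c y z) \<otimes> c x (y \<otimes>\<^bsub>P\<^esub> z)\<close> and \<open>c x y \<otimes> c (x \<otimes>\<^bsub>P\<^esub> y) z\<close> compare the same two
  automorphisms, the composite of \<open>T x\<close>, \<open>T y\<close>, \<open>T z\<close> and the lift of the product, so they differ
  by a central element of \<open>S\<close>, and this obstruction is a 3-cocycle (\<open>obstruction_centre\<close>,
  \<open>obstruction_cocycle\<close>).

  If the third cohomology is trivial, the obstruction is cohomologous to zero: it satisfies an identity
  in two central cochains \<open>m\<close> and \<open>n\<close> (\<open>obstruction_cobounds\<close>). The two cannot be combined within
  \<open>S\<close>, whose central elements need not be invertible. In \<open>G\<close> they can: central elements of \<open>S\<close>
  remain central there, so multiplying \<open>c x y\<close> by the quotient of \<open>n x y\<close> by \<open>m x y\<close> spoils none of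
  the conjugation relations and kills the obstruction (\<open>factor_set_exists\<close>). The automorphisms
  \<open>T x\<close> extend to \<open>G\<close> by the Ore condition, and the corrected \<open>c\<close> is a factor set for them. The
  crossed product of \<open>G\<close> and \<open>P\<close> that it defines (\<open>crossed_product_extension\<close>) is the extension
  sought, and it induces the right outer action since conjugation by \<open>(a, x)\<close> is the extension
  of \<open>T x\<close> followed by an inner automorphism.
\<close>

section \<open>Outer automorphisms\<close>

context monoid
begin

lemma auto_hom: "f \<in> auto G \<Longrightarrow> f \<in> hom G G"
  by (simp add: auto_def)

lemma auto_closed: "\<lbrakk>f \<in> auto G; s \<in> carrier G\<rbrakk> \<Longrightarrow> f s \<in> carrier G"
  by (rule hom_in_carrier[OF auto_hom])

lemma auto_mult: "\<lbrakk>f \<in> auto G; s \<in> carrier G; t \<in> carrier G\<rbrakk> \<Longrightarrow> f (s \<otimes> t) = f s \<otimes> f t"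
  by (rule hom_mult[OF auto_hom])

lemma auto_one: "f \<in> auto G \<Longrightarrow> f \<one> = \<one>"
  using auto_mult[of f \<one> "inv \<one>"] auto_Units[of f \<one>] Units_r_inv[of "f \<one>"] by simp

lemma auto_surj: "f \<in> auto G \<Longrightarrow> f ` carrier G = carrier G"
  by (simp add: auto_def Bij_def bij_betw_def)

lemma auto_extensional: "f \<in> auto G \<Longrightarrow> f \<in> extensional (carrier G)"
  by (simp add: auto_def Bij_def)

lemma auto_compose: "\<lbrakk>f \<in> auto G; g \<in> auto G\<rbrakk> \<Longrightarrow> compose (carrier G) f g \<in> auto G"
  by (metis AutoGroup_group carrier_AutoGroup mult_AutoGroup group.is_monoid monoid.m_closed)

lemma auto_inverse:
  assumes "f \<in> auto G"
  obtains f' where "f' \<in> auto G" "compose (carrier G) f' f = (\<lambda>s \<in> carrier G. s)"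
    "compose (carrier G) f f' = (\<lambda>s \<in> carrier G. s)"
  using group.inv_closed[OF AutoGroup_group, of f] group.l_inv[OF AutoGroup_group, of f]
    group.r_inv[OF AutoGroup_group, of f] assms
  by (metis carrier_AutoGroup mult_AutoGroup one_AutoGroup)

lemma auto_centre:
  assumes f: "f \<in> auto G" and z: "z \<in> centre G"
  shows "f z \<in> centre G"
proof -
  have "f z \<otimes> s = s \<otimes> f z" if s: "s \<in> carrier G" for s
  proof -
    obtain t where t: "t \<in> carrier G" "s = f t"
      using auto_surj[OF f] s by auto
    then show ?thesis
      using z by (simp add: centre_def flip: auto_mult[OF f])
  qed
  then show ?thesis
    using auto_closed[OF f] z by (simp add: centre_def)
qed

lemma centre_closed: "z \<in> centre G \<Longrightarrow> z \<in> carrier G"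
  by (simp add: centre_def)

lemma centre_commute: "\<lbrakk>z \<in> centre G; s \<in> carrier G\<rbrakk> \<Longrightarrow> z \<otimes> s = s \<otimes> z"
  by (simp add: centre_def)

lemma inner_aut_centre:
  assumes "u \<in> Units G" "z \<in> centre G"
  shows "inner_aut G u z = z"
proof -
  have "u \<otimes> z = z \<otimes> u" using assms by (simp add: centre_commute Units_closed)
  then show ?thesis using assms by (simp add: inner_aut_apply centre_closed m_assoc Units_closed)
qed

lemma inner_aut_mult_right:
  "\<lbrakk>u \<in> Units G; s \<in> carrier G\<rbrakk> \<Longrightarrow> inner_aut G u s \<otimes> u = u \<otimes> s"
  by (simp add: inner_aut_apply m_assoc Units_closed)

lemma mem_aut_class_iff:
  assumes "f \<in> auto G"
  shows "h \<in> aut_class G f \<longleftrightarrow> (\<exists>u \<in> Units G. h = compose (carrier G) (inner_aut G u) f)"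
  using assms
  by (auto simp: aut_class_def r_coset_def inner_auts_def mult_AutoGroup inner_aut_auto)

lemma aut_class_eqI:
  assumes "f \<in> auto G" "h \<in> aut_class G f"
  shows "aut_class G h = aut_class G f"
  using group.repr_independence[OF AutoGroup_group, of h "inner_auts G" f]
    normal_imp_subgroup[OF inner_auts_normal] assms
  by (simp add: aut_class_def carrier_AutoGroup)

lemma aut_class_inner_compose:
  "\<lbrakk>f \<in> auto G; u \<in> Units G\<rbrakk> \<Longrightarrow>
    aut_class G (compose (carrier G) (inner_aut G u) f) = aut_class G f"
  by (rule aut_class_eqI) (auto simp: mem_aut_class_iff)

text \<open>
  Elements of the outer automorphism group are handled through their representatives: any member of
  such a class may serve as one.
\<close>

lemma outer_class:
  assumes "C \<in> carrier (OutGroup G)"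
  shows "C \<noteq> {}" and "\<And>f. f \<in> C \<Longrightarrow> f \<in> auto G" and "\<And>f. f \<in> C \<Longrightarrow> C = aut_class G f"
proof -
  obtain f0 where f0: "f0 \<in> auto G" "C = aut_class G f0"
    using assms by (auto simp: OutGroup_def FactGroup_def RCOSETS_def aut_class_def carrier_AutoGroup)
  show "C \<noteq> {}"
    using mem_aut_class_iff[OF f0(1)] f0(2) Units_one_closed by blast
  show "f \<in> auto G" if "f \<in> C" for f
    using that f0 by (auto simp: mem_aut_class_iff auto_compose inner_aut_auto)
  show "C = aut_class G f" if "f \<in> C" for f
    using aut_class_eqI[OF f0(1)] that f0(2) by simp
qed

lemma OutGroup_group: "group (OutGroup G)"
  unfolding OutGroup_def by (rule normal.factorgroup_is_group[OF inner_auts_normal])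

lemma compose_mem_OutGroup_mult:
  assumes "C \<in> carrier (OutGroup G)" "D \<in> carrier (OutGroup G)" "f \<in> C" "g \<in> D"
  shows "compose (carrier G) f g \<in> C \<otimes>\<^bsub>OutGroup G\<^esub> D"
  using assms outer_class(2)[OF assms(1)] outer_class(2)[OF assms(2)]
  by (force simp: OutGroup_def FactGroup_def set_mult_def mult_AutoGroup)

lemma id_mem_OutGroup_one: "(\<lambda>s \<in> carrier G. s) \<in> \<one>\<^bsub>OutGroup G\<^esub>"
  by (auto simp: OutGroup_def FactGroup_def inner_auts_def inner_aut_one[symmetric])

end


section \<open>Twisted actions and their obstruction\<close>

text \<open>
  The data chosen when an outer action is lifted: \<open>T x (T y s)\<close> is \<open>T (x \<otimes>\<^bsub>P\<^esub> y) s\<close> conjugated by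
  \<open>c x y\<close>. The conjugation relation is written without inverses, so that identities can be derived by
  cancellation in a monoid; the same locale then serves for the monoid \<open>S\<close> and for its group of fractions.
  The normalization at the neutral element matches the one in the definition of cocycles.
\<close>

locale twisted_action = P: group P + monoid_cancel S
  for P :: "('p, 'm) monoid_scheme" and S :: "('s, 'n) monoid_scheme" (structure) +
  fixes T :: "'p \<Rightarrow> 's \<Rightarrow> 's" and c :: "'p \<Rightarrow> 'p \<Rightarrow> 's"
  assumes T_auto: "x \<in> carrier P \<Longrightarrow> T x \<in> auto S"
    and c_Units: "\<lbrakk>x \<in> carrier P; y \<in> carrier P\<rbrakk> \<Longrightarrow> c x y \<in> Units S"
    and T_T: "\<lbrakk>x \<in> carrier P; y \<in> carrier P; s \<in> carrier S\<rbrakk>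
      \<Longrightarrow> T x (T y s) \<otimes> c x y = c x y \<otimes> T (x \<otimes>\<^bsub>P\<^esub> y) s"
    and T_one: "s \<in> carrier S \<Longrightarrow> T \<one>\<^bsub>P\<^esub> s = s"
    and c_one: "x \<in> carrier P \<Longrightarrow> c \<one>\<^bsub>P\<^esub> x = \<one>" "x \<in> carrier P \<Longrightarrow> c x \<one>\<^bsub>P\<^esub> = \<one>"

lemma twisted_action_exists:
  assumes "group P" and "monoid_cancel S" and \<phi>: "\<phi> \<in> hom P (OutGroup S)"
  obtains T c where "twisted_action P S T c" and "\<And>x. x \<in> carrier P \<Longrightarrow> T x \<in> \<phi> x"
proof -
  interpret P: group P by fact
  interpret S: monoid_cancel S by fact
  have \<phi>_carrier: "\<phi> x \<in> carrier (OutGroup S)" if "x \<in> carrier P" for x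
    using \<phi> that by (rule hom_in_carrier)
  have \<phi>_one: "\<phi> \<one>\<^bsub>P\<^esub> = \<one>\<^bsub>OutGroup S\<^esub>"
    by (rule hom_one[OF \<phi> P.is_group S.OutGroup_group])
  \<comment> \<open>The identity has to be chosen over the neutral element for \<open>c\<close> to be normalized.\<close>
  define T where
    "T x = (if x = \<one>\<^bsub>P\<^esub> then (\<lambda>s \<in> carrier S. s) else (SOME f. f \<in> \<phi> x))" for x
  have T: "T x \<in> \<phi> x" if "x \<in> carrier P" for x
    using S.outer_class(1)[OF \<phi>_carrier[OF that]] S.id_mem_OutGroup_one \<phi>_one
    by (auto simp: T_def some_in_eq)
  have T_auto: "T x \<in> auto S" if "x \<in> carrier P" for x
    using S.outer_class(2)[OF \<phi>_carrier T] that by simp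
  have T_one: "T \<one>\<^bsub>P\<^esub> s = s" if "s \<in> carrier S" for s
    using that by (simp add: T_def)
  have ex: "\<exists>u \<in> Units S. (\<forall>s \<in> carrier S. T x (T y s) \<otimes>\<^bsub>S\<^esub> u = u \<otimes>\<^bsub>S\<^esub> T (x \<otimes>\<^bsub>P\<^esub> y) s)
      \<and> (x = \<one>\<^bsub>P\<^esub> \<or> y = \<one>\<^bsub>P\<^esub> \<longrightarrow> u = \<one>\<^bsub>S\<^esub>)"
    if xy: "x \<in> carrier P" "y \<in> carrier P" for x y
  proof (cases "x = \<one>\<^bsub>P\<^esub> \<or> y = \<one>\<^bsub>P\<^esub>")
    case True
    then show ?thesis
      using xy by (intro bexI[of _ "\<one>\<^bsub>S\<^esub>"]) (auto simp: T_one S.auto_closed[OF T_auto])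
  next
    case False
    have xy': "x \<otimes>\<^bsub>P\<^esub> y \<in> carrier P" using xy by simp
    have "compose (carrier S) (T x) (T y) \<in> \<phi> (x \<otimes>\<^bsub>P\<^esub> y)"
      using S.compose_mem_OutGroup_mult[OF \<phi>_carrier \<phi>_carrier T T] xy
      by (simp add: hom_mult[OF \<phi>])
    then have "compose (carrier S) (T x) (T y) \<in> aut_class S (T (x \<otimes>\<^bsub>P\<^esub> y))"
      using S.outer_class(3)[OF \<phi>_carrier[OF xy'] T[OF xy']] by simp
    then obtain u where u: "u \<in> Units S"
      and eq: "compose (carrier S) (T x) (T y)
        = compose (carrier S) (inner_aut S u) (T (x \<otimes>\<^bsub>P\<^esub> y))"
      using S.mem_aut_class_iff[OF T_auto[OF xy']] by blast
    have "T x (T y s) \<otimes>\<^bsub>S\<^esub> u = u \<otimes>\<^bsub>S\<^esub> T (x \<otimes>\<^bsub>P\<^esub> y) s" if s: "s \<in> carrier S" for s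
      using fun_cong[OF eq, of s] s u xy'
      by (simp add: compose_eq S.inner_aut_mult_right S.auto_closed[OF T_auto])
    then show ?thesis using u False by blast
  qed
  then obtain c where c: "\<And>x y. \<lbrakk>x \<in> carrier P; y \<in> carrier P\<rbrakk> \<Longrightarrow> c x y \<in> Units S
      \<and> (\<forall>s \<in> carrier S. T x (T y s) \<otimes>\<^bsub>S\<^esub> c x y = c x y \<otimes>\<^bsub>S\<^esub> T (x \<otimes>\<^bsub>P\<^esub> y) s)
      \<and> (x = \<one>\<^bsub>P\<^esub> \<or> y = \<one>\<^bsub>P\<^esub> \<longrightarrow> c x y = \<one>\<^bsub>S\<^esub>)"
    by metis
  have c_one: "c \<one>\<^bsub>P\<^esub> x = \<one>\<^bsub>S\<^esub>" "c x \<one>\<^bsub>P\<^esub> = \<one>\<^bsub>S\<^esub>" if "x \<in> carrier P" for x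
    using c[of "\<one>\<^bsub>P\<^esub>" x] c[of x "\<one>\<^bsub>P\<^esub>"] that by simp_all
  have "twisted_action P S T c"
    by unfold_locales (use c c_one T_auto T_one in \<open>simp_all\<close>)
  then show thesis using T that by blast
qed

context twisted_action
begin

lemma c_closed: "\<lbrakk>x \<in> carrier P; y \<in> carrier P\<rbrakk> \<Longrightarrow> c x y \<in> carrier S"
  by (rule Units_closed[OF c_Units])

lemma T_closed: "\<lbrakk>x \<in> carrier P; s \<in> carrier S\<rbrakk> \<Longrightarrow> T x s \<in> carrier S"
  by (rule auto_closed[OF T_auto])

lemma T_mult:
  "\<lbrakk>x \<in> carrier P; s \<in> carrier S; t \<in> carrier S\<rbrakk> \<Longrightarrow> T x (s \<otimes> t) = T x s \<otimes> T x t"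
  by (rule auto_mult[OF T_auto])

lemmas closed = c_closed T_closed

definition obstruction :: "'p \<Rightarrow> 'p \<Rightarrow> 'p \<Rightarrow> 's" where
  "obstruction x y z = T x (c y z) \<otimes> c x (y \<otimes>\<^bsub>P\<^esub> z) \<otimes> inv (c x y \<otimes> c (x \<otimes>\<^bsub>P\<^esub> y) z)"

lemma obstruction_closed:
  "\<lbrakk>x \<in> carrier P; y \<in> carrier P; z \<in> carrier P\<rbrakk> \<Longrightarrow> obstruction x y z \<in> carrier S"
  by (simp add: obstruction_def closed c_Units)

lemma obstruction_mult:
  "\<lbrakk>x \<in> carrier P; y \<in> carrier P; z \<in> carrier P\<rbrakk> \<Longrightarrow>
    obstruction x y z \<otimes> (c x y \<otimes> c (x \<otimes>\<^bsub>P\<^esub> y) z) = T x (c y z) \<otimes> c x (y \<otimes>\<^bsub>P\<^esub> z)"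
  by (simp add: obstruction_def closed c_Units m_assoc[of _ "inv _"])

text \<open>
  The bracketings of \<open>T x (T y (T z s))\<close> show that \<open>w = c x y \<otimes> c (x \<otimes>\<^bsub>P\<^esub> y) z\<close> and
  \<open>obstruction x y z \<otimes> w\<close> both intertwine \<open>T (x \<otimes>\<^bsub>P\<^esub> y \<otimes>\<^bsub>P\<^esub> z)\<close> with the composite of \<open>T x\<close>,
  \<open>T y\<close>, \<open>T z\<close>. Hence the obstruction commutes with every value of that composite, which is
  surjective.
\<close>

lemma obstruction_centre:
  assumes xyz: "x \<in> carrier P" "y \<in> carrier P" "z \<in> carrier P"
  shows "obstruction x y z \<in> centre S"
proof -
  let ?F = "obstruction x y z"
  define w where "w = c x y \<otimes> c (x \<otimes>\<^bsub>P\<^esub> y) z"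
  have w: "w \<in> carrier S" using xyz by (simp add: w_def closed)
  have F: "?F \<in> carrier S" using xyz by (rule obstruction_closed)
  have "?F \<otimes> s' = s' \<otimes> ?F" if s': "s' \<in> carrier S" for s'
  proof -
    obtain s where s: "s \<in> carrier S" "s' = T x (T y (T z s))"
      using s' auto_surj[OF T_auto] xyz by (metis imageE)
    define t where "t = T (x \<otimes>\<^bsub>P\<^esub> y \<otimes>\<^bsub>P\<^esub> z) s"
    have t: "t \<in> carrier S" using s xyz by (simp add: t_def closed)
    have left: "w \<otimes> t = s' \<otimes> w"
    proof -
      have "w \<otimes> t = c x y \<otimes> (T (x \<otimes>\<^bsub>P\<^esub> y) (T z s) \<otimes> c (x \<otimes>\<^bsub>P\<^esub> y) z)"
        using xyz s by (simp add: w_def t_def T_T closed m_assoc)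
      also have "\<dots> = T x (T y (T z s)) \<otimes> c x y \<otimes> c (x \<otimes>\<^bsub>P\<^esub> y) z"
        using xyz s by (simp add: T_T[of x y] closed flip: m_assoc)
      finally show ?thesis using xyz s by (simp add: w_def closed m_assoc)
    qed
    have right: "?F \<otimes> w \<otimes> t = s' \<otimes> (?F \<otimes> w)"
    proof -
      have "?F \<otimes> w \<otimes> t = T x (c y z) \<otimes> (c x (y \<otimes>\<^bsub>P\<^esub> z) \<otimes> t)"
        using xyz t by (simp add: w_def obstruction_mult closed m_assoc)
      also have "\<dots> = T x (c y z) \<otimes> (T x (T (y \<otimes>\<^bsub>P\<^esub> z) s) \<otimes> c x (y \<otimes>\<^bsub>P\<^esub> z))"
        using xyz s by (simp add: T_T t_def P.m_assoc)
      also have "\<dots> = T x (c y z \<otimes> T (y \<otimes>\<^bsub>P\<^esub> z) s) \<otimes> c x (y \<otimes>\<^bsub>P\<^esub> z)"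
        using xyz s by (simp add: T_mult closed m_assoc)
      also have "\<dots> = T x (T y (T z s) \<otimes> c y z) \<otimes> c x (y \<otimes>\<^bsub>P\<^esub> z)"
        using xyz s by (simp add: T_T)
      also have "\<dots> = s' \<otimes> (?F \<otimes> w)"
        using xyz s by (simp add: w_def obstruction_mult T_mult closed m_assoc)
      finally show ?thesis .
    qed
    have "?F \<otimes> s' \<otimes> w = s' \<otimes> ?F \<otimes> w"
      using left right w t F s' by (simp add: m_assoc)
    then show ?thesis
      by (rule r_cancel) (use F w s' in auto)
  qed
  then show ?thesis using F by (simp add: centre_def)
qed

lemma obstruction_one:
  assumes "x \<in> carrier P" "y \<in> carrier P"
  shows "obstruction \<one>\<^bsub>P\<^esub> x y = \<one>" "obstruction x \<one>\<^bsub>P\<^esub> y = \<one>" "obstruction x y \<one>\<^bsub>P\<^esub> = \<one>"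
  using assms by (simp_all add: obstruction_def T_one c_one closed c_Units auto_one[OF T_auto])

text \<open>
  The element \<open>J\<close> below is pushed in two ways to the form (central element) \<open>\<otimes> w\<close>, where \<open>w\<close> is
  the product of the \<open>c\<close> for multiplying \<open>x\<close>, \<open>y\<close>, \<open>z\<close>, \<open>t\<close> from the left. The first way
  reduces inside \<open>T x\<close>, the second splits \<open>T x\<close> over the product and uses the conjugation relation
  for \<open>T x (T y (c z t))\<close>. Cancelling \<open>w\<close> leaves the cocycle identity.
\<close>

lemma obstruction_cocycle:
  assumes P: "x \<in> carrier P" "y \<in> carrier P" "z \<in> carrier P" "t \<in> carrier P"
  shows "T x (obstruction y z t) \<otimes> obstruction x (y \<otimes>\<^bsub>P\<^esub> z) t \<otimes> obstruction x y z
    = obstruction (x \<otimes>\<^bsub>P\<^esub> y) z t \<otimes> obstruction x y (z \<otimes>\<^bsub>P\<^esub> t)"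
proof -
  let ?F = obstruction and ?m = "\<lambda>x y. x \<otimes>\<^bsub>P\<^esub> y"
  define w where "w = c x y \<otimes> (c (?m x y) z \<otimes> c (?m (?m x y) z) t)"
  define J where "J = T x (T y (c z t) \<otimes> c y (?m z t)) \<otimes> c x (?m y (?m z t))"
  note cl = closed obstruction_closed P
  have w: "w \<in> carrier S" by (simp add: w_def cl)
  have "J = T x (?F y z t \<otimes> (c y z \<otimes> c (?m y z) t)) \<otimes> c x (?m y (?m z t))"
    by (simp add: J_def obstruction_mult P)
  also have "\<dots> = T x (?F y z t) \<otimes> (T x (c y z) \<otimes> (T x (c (?m y z) t) \<otimes> c x (?m (?m y z) t)))"
    by (simp add: T_mult m_assoc P.m_assoc cl)
  also have "\<dots> = T x (?F y z t)
      \<otimes> (T x (c y z) \<otimes> (?F x (?m y z) t \<otimes> (c x (?m y z) \<otimes> c (?m x (?m y z)) t)))"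
    by (simp add: obstruction_mult[of x "?m y z" t] P)
  also have "\<dots> = T x (?F y z t) \<otimes> (?F x (?m y z) t
      \<otimes> (T x (c y z) \<otimes> c x (?m y z) \<otimes> c (?m (?m x y) z) t))"
  proof -
    have "T x (c y z) \<otimes> (?F x (?m y z) t \<otimes> r) = ?F x (?m y z) t \<otimes> (T x (c y z) \<otimes> r)"
      if "r \<in> carrier S" for r
      using centre_commute[OF obstruction_centre, of x "?m y z" t "T x (c y z)"] that
      by (simp add: cl flip: m_assoc)
    then show ?thesis by (simp add: m_assoc P.m_assoc cl)
  qed
  also have "\<dots> = T x (?F y z t) \<otimes> ?F x (?m y z) t \<otimes> ?F x y z \<otimes> w"
    by (simp add: obstruction_mult[of x y z, symmetric] w_def m_assoc cl)
  finally have left: "J = T x (?F y z t) \<otimes> ?F x (?m y z) t \<otimes> ?F x y z \<otimes> w" .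
  have "J = T x (T y (c z t)) \<otimes> (T x (c y (?m z t)) \<otimes> c x (?m y (?m z t)))"
    by (simp add: J_def T_mult m_assoc cl)
  also have "\<dots> = T x (T y (c z t)) \<otimes> (?F x y (?m z t) \<otimes> (c x y \<otimes> c (?m x y) (?m z t)))"
    by (simp add: obstruction_mult P)
  also have "\<dots> = ?F x y (?m z t) \<otimes> (T x (T y (c z t)) \<otimes> c x y \<otimes> c (?m x y) (?m z t))"
    using centre_commute[OF obstruction_centre, of x y "?m z t" "T x (T y (c z t))"]
    by (simp add: cl flip: m_assoc)
  also have "\<dots> = ?F x y (?m z t) \<otimes> (c x y \<otimes> (T (?m x y) (c z t) \<otimes> c (?m x y) (?m z t)))"
    by (simp add: T_T m_assoc cl)
  also have "\<dots> = ?F x y (?m z t)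
      \<otimes> (c x y \<otimes> (?F (?m x y) z t \<otimes> (c (?m x y) z \<otimes> c (?m (?m x y) z) t)))"
    by (simp add: obstruction_mult P)
  also have "\<dots> = ?F x y (?m z t) \<otimes> (?F (?m x y) z t \<otimes> w)"
    using centre_commute[OF obstruction_centre, of "?m x y" z t "c x y"]
    by (simp add: w_def cl flip: m_assoc)
  also have "\<dots> = ?F (?m x y) z t \<otimes> ?F x y (?m z t) \<otimes> w"
    using centre_commute[OF obstruction_centre, of "?m x y" z t "?F x y (?m z t)"] w
    by (simp add: cl flip: m_assoc)
  finally have right: "J = ?F (?m x y) z t \<otimes> ?F x y (?m z t) \<otimes> w" .
  show ?thesis
    using left[symmetric, THEN trans, OF right] by (rule r_cancel) (simp_all add: cl w)
qed

end


section \<open>Crossed products\<close>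

locale factor_set = G?: group G + twisted_action P G T c
  for P :: "('p, 'm) monoid_scheme" and G :: "('g, 'n) monoid_scheme" (structure)
    and T :: "'p \<Rightarrow> 'g \<Rightarrow> 'g" and c :: "'p \<Rightarrow> 'p \<Rightarrow> 'g" +
  assumes factor: "\<lbrakk>x \<in> carrier P; y \<in> carrier P; z \<in> carrier P\<rbrakk>
    \<Longrightarrow> T x (c y z) \<otimes> c x (y \<otimes>\<^bsub>P\<^esub> z) = c x y \<otimes> c (x \<otimes>\<^bsub>P\<^esub> y) z"
begin

definition crossed_product :: "('g \<times> 'p) monoid" where
  "crossed_product = \<lparr>carrier = carrier G \<times> carrier P,
    monoid.mult = (\<lambda>(a, x) (b, y). (a \<otimes> T x b \<otimes> c x y, x \<otimes>\<^bsub>P\<^esub> y)),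
    one = (\<one>, \<one>\<^bsub>P\<^esub>)\<rparr>"

lemma carrier_crossed_product: "carrier crossed_product = carrier G \<times> carrier P"
  and mult_crossed_product:
    "(a, x) \<otimes>\<^bsub>crossed_product\<^esub> (b, y) = (a \<otimes> T x b \<otimes> c x y, x \<otimes>\<^bsub>P\<^esub> y)"
  and one_crossed_product: "\<one>\<^bsub>crossed_product\<^esub> = (\<one>, \<one>\<^bsub>P\<^esub>)"
  by (simp_all add: crossed_product_def)

lemmas crossed_product_simps =
  carrier_crossed_product mult_crossed_product one_crossed_product

lemma crossed_product_assoc:
  assumes "a \<in> carrier G" "b \<in> carrier G" "d \<in> carrier G"
    and P: "x \<in> carrier P" "y \<in> carrier P" "z \<in> carrier P"
  shows "a \<otimes> T x b \<otimes> c x y \<otimes> T (x \<otimes>\<^bsub>P\<^esub> y) d \<otimes> c (x \<otimes>\<^bsub>P\<^esub> y) z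
    = a \<otimes> T x (b \<otimes> T y d \<otimes> c y z) \<otimes> c x (y \<otimes>\<^bsub>P\<^esub> z)"
proof -
  note cl = assms closed
  have "a \<otimes> T x b \<otimes> c x y \<otimes> T (x \<otimes>\<^bsub>P\<^esub> y) d \<otimes> c (x \<otimes>\<^bsub>P\<^esub> y) z
      = a \<otimes> T x b \<otimes> (c x y \<otimes> T (x \<otimes>\<^bsub>P\<^esub> y) d) \<otimes> c (x \<otimes>\<^bsub>P\<^esub> y) z"
    by (simp add: m_assoc cl)
  also have "\<dots> = a \<otimes> T x b \<otimes> T x (T y d) \<otimes> (c x y \<otimes> c (x \<otimes>\<^bsub>P\<^esub> y) z)"
    by (simp add: m_assoc cl flip: T_T)
  also have "\<dots> = a \<otimes> T x (b \<otimes> T y d \<otimes> c y z) \<otimes> c x (y \<otimes>\<^bsub>P\<^esub> z)"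
    by (simp add: m_assoc cl T_mult flip: factor)
  finally show ?thesis .
qed

lemma crossed_product_group: "group crossed_product"
proof (rule groupI)
  let ?B = crossed_product
  show "u \<otimes>\<^bsub>?B\<^esub> v \<in> carrier ?B" if "u \<in> carrier ?B" "v \<in> carrier ?B" for u v
    using that by (auto simp: crossed_product_simps closed)
  show "\<one>\<^bsub>?B\<^esub> \<in> carrier ?B"
    by (simp add: crossed_product_simps)
  show "u \<otimes>\<^bsub>?B\<^esub> v \<otimes>\<^bsub>?B\<^esub> w = u \<otimes>\<^bsub>?B\<^esub> (v \<otimes>\<^bsub>?B\<^esub> w)"
    if "u \<in> carrier ?B" "v \<in> carrier ?B" "w \<in> carrier ?B" for u v w
    using that by (auto simp: crossed_product_simps crossed_product_assoc P.m_assoc)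
  show "\<one>\<^bsub>?B\<^esub> \<otimes>\<^bsub>?B\<^esub> u = u" if "u \<in> carrier ?B" for u
    using that by (auto simp: crossed_product_simps T_one c_one)
  show "\<exists>v \<in> carrier ?B. v \<otimes>\<^bsub>?B\<^esub> u = \<one>\<^bsub>?B\<^esub>" if "u \<in> carrier ?B" for u
  proof -
    obtain a x where u: "u = (a, x)" "a \<in> carrier G" "x \<in> carrier P"
      using \<open>u \<in> carrier ?B\<close> by (auto simp: crossed_product_simps)
    let ?y = "inv\<^bsub>P\<^esub> x"
    have "T ?y a \<otimes> c ?y x \<in> carrier G" using u by (simp add: closed)
    then show ?thesis using u
      by (intro bexI[of _ "(inv (T ?y a \<otimes> c ?y x), ?y)"])
        (simp_all add: crossed_product_simps m_assoc closed)
  qed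
qed

lemma crossed_product_extension:
  "group_extension P G crossed_product (\<lambda>a. (a, \<one>\<^bsub>P\<^esub>)) snd"
proof -
  have "(\<lambda>a. (a, \<one>\<^bsub>P\<^esub>)) \<in> mon G crossed_product"
    by (auto simp: mon_def hom_def inj_on_def crossed_product_simps T_one c_one)
  moreover have "snd \<in> epi crossed_product P"
    using G.one_closed by (auto simp: epi_def hom_def crossed_product_simps)
  moreover have "kernel crossed_product P snd = (\<lambda>a. (a, \<one>\<^bsub>P\<^esub>)) ` carrier G"
    by (auto simp: kernel_def crossed_product_simps)
  ultimately show ?thesis
    by (simp add: group_extension_def crossed_product_group P.is_group G.is_group)
qed

text \<open>
  From \<open>(a, x) (g, 1) = (a \<otimes> T x g, x)\<close> and \<open>(h, 1) (a, x) = (h \<otimes> a, x)\<close>: conjugating \<open>g\<close> by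
  \<open>(a, x)\<close> gives the \<open>h\<close> with \<open>h \<otimes> a = a \<otimes> T x g\<close>.
\<close>

lemma crossed_product_conj:
  assumes a: "a \<in> carrier G" and x: "x \<in> carrier P"
  shows "conj_aut G crossed_product (\<lambda>a. (a, \<one>\<^bsub>P\<^esub>)) (a, x)
    = compose (carrier G) (inner_aut G a) (T x)"
proof
  fix g
  interpret B: group crossed_product by (rule crossed_product_group)
  let ?j = "\<lambda>a. (a, \<one>\<^bsub>P\<^esub>)"
  have inj: "inj_on ?j (carrier G)" by (simp add: inj_on_def)
  show "conj_aut G crossed_product ?j (a, x) g = compose (carrier G) (inner_aut G a) (T x) g"
  proof (cases "g \<in> carrier G")
    case True
    define h where "h = inner_aut G a (T x g)"
    have h: "h \<in> carrier G"
      using a x True by (simp add: h_def inner_aut_apply closed)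
    have ax: "(a, x) \<in> carrier crossed_product" "?j g \<in> carrier crossed_product"
        "?j h \<in> carrier crossed_product"
      using a x True h by (simp_all add: crossed_product_simps)
    have "h \<otimes> a = a \<otimes> T x g"
      using a x True by (simp add: h_def inner_aut_mult_right closed)
    then have "(a, x) \<otimes>\<^bsub>crossed_product\<^esub> ?j g = ?j h \<otimes>\<^bsub>crossed_product\<^esub> (a, x)"
      using a x True by (simp add: crossed_product_simps T_one c_one closed)
    then have "(a, x) \<otimes>\<^bsub>crossed_product\<^esub> ?j g \<otimes>\<^bsub>crossed_product\<^esub> inv\<^bsub>crossed_product\<^esub> (a, x) = ?j h"
      using ax by (simp add: B.m_assoc)
    then show ?thesis
      using True h inv_into_f_f[OF inj h] by (simp add: conj_aut_def compose_eq h_def)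
  qed (simp add: conj_aut_def compose_def)
qed

lemma crossed_product_induces:
  assumes "\<And>x. x \<in> carrier P \<Longrightarrow> \<psi> x = aut_class G (T x)"
  shows "induces G crossed_product (\<lambda>a. (a, \<one>\<^bsub>P\<^esub>)) snd \<psi>"
  using assms
  by (auto simp: induces_def carrier_crossed_product crossed_product_conj
      aut_class_inner_compose T_auto)

end


section \<open>Central corrections\<close>

lemma (in group) inv_centre: "z \<in> centre G \<Longrightarrow> inv z \<in> centre G"
  by (auto simp: centre_def inv_solve_left inv_solve_right m_assoc)

lemma (in monoid_cancel) centre_comm_monoid_cancel: "comm_monoid_cancel (centre_monoid G)"
proof (rule comm_monoid_cancelI)
  have "x \<otimes> y \<in> centre G" if xy: "x \<in> centre G" "y \<in> centre G" for x y
  proof -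
    have "x \<otimes> y \<otimes> s = s \<otimes> (x \<otimes> y)" if s: "s \<in> carrier G" for s
    proof -
      have "x \<otimes> y \<otimes> s = x \<otimes> s \<otimes> y"
        using xy s centre_commute[OF xy(2) s] by (simp add: m_assoc centre_closed)
      then show ?thesis
        using xy s centre_commute[OF xy(1) s] by (simp add: centre_closed flip: m_assoc)
    qed
    then show ?thesis using centre_closed[OF xy(1)] centre_closed[OF xy(2)] by (simp add: centre_def)
  qed
  moreover have "\<one> \<in> centre G" by (simp add: centre_def)
  ultimately show "comm_monoid (centre_monoid G)"
    using centre_closed
    by (intro comm_monoidI) (simp_all add: centre_monoid_def m_assoc, simp add: centre_commute)
next
  fix a b c
  assume "a \<otimes>\<^bsub>centre_monoid G\<^esub> c = b \<otimes>\<^bsub>centre_monoid G\<^esub> c" "a \<in> carrier (centre_monoid G)"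
    "b \<in> carrier (centre_monoid G)" "c \<in> carrier (centre_monoid G)"
  then show "a = b" using r_cancel[of a c b] by (simp add: centre_monoid_def centre_closed)
qed

text \<open>
  If \<open>k\<^sub>j = n\<^sub>j - m\<^sub>j\<close> in additive notation, this rewrites an identity between the \<open>n\<^sub>j\<close> and the
  \<open>m\<^sub>j\<close>, the shape in which cohomologous cocycles are given, as an identity between the differences.
\<close>

lemma (in comm_monoid_cancel) cancel_common_terms:
  assumes "f \<in> carrier G" "m1 \<in> carrier G" "m2 \<in> carrier G" "m3 \<in> carrier G" "m4 \<in> carrier G"
    "k1 \<in> carrier G" "k2 \<in> carrier G" "k3 \<in> carrier G" "k4 \<in> carrier G"
    and eq: "f \<otimes> m1 \<otimes> m2 \<otimes> (k3 \<otimes> m3) \<otimes> (k4 \<otimes> m4) = (k1 \<otimes> m1) \<otimes> (k2 \<otimes> m2) \<otimes> m3 \<otimes> m4"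
  shows "f \<otimes> k3 \<otimes> k4 = k1 \<otimes> k2"
proof (rule r_cancel)
  show "f \<otimes> k3 \<otimes> k4 \<otimes> (m1 \<otimes> m2 \<otimes> m3 \<otimes> m4) = k1 \<otimes> k2 \<otimes> (m1 \<otimes> m2 \<otimes> m3 \<otimes> m4)"
    using eq assms(1-9) by (simp add: m_ac)
qed (simp_all add: assms(1-9))

text \<open>
  A central factor \<open>k\<close> leaves the conjugation relation intact and changes the obstruction by the
  coboundary of \<open>k\<close>; the hypothesis on \<open>k\<close> says that the changed obstruction is trivial.
\<close>

lemma (in twisted_action) factor_set_of_trivial_obstruction:
  assumes "group S"
    and k: "\<And>x y. \<lbrakk>x \<in> carrier P; y \<in> carrier P\<rbrakk> \<Longrightarrow> k x y \<in> centre S"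
    and k_one: "\<And>x. x \<in> carrier P \<Longrightarrow> k \<one>\<^bsub>P\<^esub> x = \<one>" "\<And>x. x \<in> carrier P \<Longrightarrow> k x \<one>\<^bsub>P\<^esub> = \<one>"
    and k_obstruction: "\<And>x y z. \<lbrakk>x \<in> carrier P; y \<in> carrier P; z \<in> carrier P\<rbrakk> \<Longrightarrow>
      obstruction x y z \<otimes> T x (k y z) \<otimes> k x (y \<otimes>\<^bsub>P\<^esub> z) = k (x \<otimes>\<^bsub>P\<^esub> y) z \<otimes> k x y"
  shows "factor_set P S T (\<lambda>x y. c x y \<otimes> k x y)"
proof -
  interpret group S by fact
  note k_closed = centre_closed[OF k]
  show ?thesis
  proof unfold_locales
    fix x y s assume xys: "x \<in> carrier P" "y \<in> carrier P" "s \<in> carrier S"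
    show "T x (T y s) \<otimes> (c x y \<otimes> k x y) = c x y \<otimes> k x y \<otimes> T (x \<otimes>\<^bsub>P\<^esub> y) s"
      using xys centre_commute[OF k, of x y "T (x \<otimes>\<^bsub>P\<^esub> y) s"]
      by (simp add: m_assoc T_T closed k_closed flip: m_assoc[of "T x (T y s)"])
  next
    fix x y z assume P: "x \<in> carrier P" "y \<in> carrier P" "z \<in> carrier P"
    let ?m = "\<lambda>x y. x \<otimes>\<^bsub>P\<^esub> y" and ?F = "obstruction x y z"
    note cl = P closed k_closed obstruction_closed
    define w where "w = c x y \<otimes> c (?m x y) z"
    have w: "w \<in> carrier S" by (simp add: w_def cl)
    have Tk: "T x (k y z) \<in> centre S"
      using P by (simp add: auto_centre[OF T_auto] k)
    have "T x (c y z \<otimes> k y z) \<otimes> (c x (?m y z) \<otimes> k x (?m y z))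
        = T x (c y z) \<otimes> (T x (k y z) \<otimes> c x (?m y z)) \<otimes> k x (?m y z)"
      by (simp add: T_mult m_assoc cl)
    also have "\<dots> = T x (c y z) \<otimes> c x (?m y z) \<otimes> (T x (k y z) \<otimes> k x (?m y z))"
      using centre_commute[OF Tk, of "c x (?m y z)"] by (simp add: m_assoc cl)
    also have "\<dots> = w \<otimes> (?F \<otimes> T x (k y z) \<otimes> k x (?m y z))"
      using centre_commute[OF obstruction_centre[OF P] w] w
      by (simp add: m_assoc cl w_def flip: obstruction_mult)
    also have "\<dots> = w \<otimes> (k (?m x y) z \<otimes> k x y)"
      by (simp add: k_obstruction P)
    also have "\<dots> = c x y \<otimes> (c (?m x y) z \<otimes> k x y) \<otimes> k (?m x y) z"
      using centre_commute[OF k, of "?m x y" z "k x y"] by (simp add: w_def m_assoc cl)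
    also have "\<dots> = c x y \<otimes> k x y \<otimes> (c (?m x y) z \<otimes> k (?m x y) z)"
      using centre_commute[OF k, of x y "c (?m x y) z"]
      by (simp add: m_assoc cl) (simp add: cl flip: m_assoc)
    finally show "T x (c y z \<otimes> k y z) \<otimes> (c x (?m y z) \<otimes> k x (?m y z))
      = c x y \<otimes> k x y \<otimes> (c (?m x y) z \<otimes> k (?m x y) z)" .
  qed (simp_all add: T_auto T_one c_one k_one closed k_closed)
qed


section \<open>Extending automorphisms to the group of left fractions\<close>

locale left_fractions = Ore_monoid S + G: group G
  for S :: "('s, 'm) monoid_scheme" (structure) and G :: "('g, 'n) monoid_scheme"
    and i :: "'s \<Rightarrow> 'g" +
  assumes left_fractions: "left_fraction_group S G i"
begin

lemma i_closed: "s \<in> carrier S \<Longrightarrow> i s \<in> carrier G"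
  and i_mult: "\<lbrakk>s \<in> carrier S; t \<in> carrier S\<rbrakk> \<Longrightarrow> i (s \<otimes> t) = i s \<otimes>\<^bsub>G\<^esub> i t"
  and i_inj: "\<lbrakk>i s = i t; s \<in> carrier S; t \<in> carrier S\<rbrakk> \<Longrightarrow> s = t"
  and i_one: "i \<one> = \<one>\<^bsub>G\<^esub>"
  using left_fractions by (auto simp: left_fraction_group_def mon_def hom_def inj_on_def)

lemma fraction_cases:
  assumes "g \<in> carrier G"
  obtains s t where "s \<in> carrier S" "t \<in> carrier S" "g = inv\<^bsub>G\<^esub> (i s) \<otimes>\<^bsub>G\<^esub> i t"
  using left_fractions assms unfolding left_fraction_group_def by blast

lemma i_inv: "u \<in> Units S \<Longrightarrow> i (inv u) = inv\<^bsub>G\<^esub> (i u)"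
  by (rule G.inv_equality[symmetric]) (simp_all add: i_closed i_one Units_closed flip: i_mult)

lemma common_multiple:
  assumes "s \<in> carrier S" "t \<in> carrier S"
  obtains a b where "a \<in> carrier S" "b \<in> carrier S" "a \<otimes> s = b \<otimes> t"
  using ore[OF assms] by auto

lemma fraction_mult_left:
  assumes "a \<in> carrier S" "s \<in> carrier S" "t \<in> carrier S"
  shows "inv\<^bsub>G\<^esub> (i (a \<otimes> s)) \<otimes>\<^bsub>G\<^esub> i (a \<otimes> t) = inv\<^bsub>G\<^esub> (i s) \<otimes>\<^bsub>G\<^esub> i t"
  using assms by (simp add: i_mult i_closed G.inv_mult_group G.m_assoc
      flip: G.m_assoc[of "inv\<^bsub>G\<^esub> (i a)"])

text \<open>
  Expanding two fractions to the common denominator \<open>a \<otimes> s = b \<otimes> s'\<close> expresses their equality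
  inside \<open>S\<close>, where automorphisms of \<open>S\<close> can be applied to it.
\<close>

lemma fraction_eq_iff:
  assumes "s \<in> carrier S" "t \<in> carrier S" "s' \<in> carrier S" "t' \<in> carrier S"
    "a \<in> carrier S" "b \<in> carrier S" and ab: "a \<otimes> s = b \<otimes> s'"
  shows "inv\<^bsub>G\<^esub> (i s) \<otimes>\<^bsub>G\<^esub> i t = inv\<^bsub>G\<^esub> (i s') \<otimes>\<^bsub>G\<^esub> i t' \<longleftrightarrow> a \<otimes> t = b \<otimes> t'"
proof -
  have "inv\<^bsub>G\<^esub> (i s) \<otimes>\<^bsub>G\<^esub> i t = inv\<^bsub>G\<^esub> (i s') \<otimes>\<^bsub>G\<^esub> i t'
    \<longleftrightarrow> inv\<^bsub>G\<^esub> (i (a \<otimes> s)) \<otimes>\<^bsub>G\<^esub> i (a \<otimes> t) = inv\<^bsub>G\<^esub> (i (a \<otimes> s)) \<otimes>\<^bsub>G\<^esub> i (b \<otimes> t')"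
    using assms fraction_mult_left[of a s t] fraction_mult_left[of b s' t'] by simp
  also have "\<dots> \<longleftrightarrow> a \<otimes> t = b \<otimes> t'"
    using assms(1-6) by (auto simp: i_closed dest: i_inj)
  finally show ?thesis .
qed

lemma extend_aut_fraction:
  assumes f: "f \<in> auto S" and st: "s \<in> carrier S" "t \<in> carrier S"
  shows "extend_aut S G i f (inv\<^bsub>G\<^esub> (i s) \<otimes>\<^bsub>G\<^esub> i t) = inv\<^bsub>G\<^esub> (i (f s)) \<otimes>\<^bsub>G\<^esub> i (f t)"
proof -
  have *: "inv\<^bsub>G\<^esub> (i (f s')) \<otimes>\<^bsub>G\<^esub> i (f t') = inv\<^bsub>G\<^esub> (i (f s)) \<otimes>\<^bsub>G\<^esub> i (f t)"
    if s't': "s' \<in> carrier S" "t' \<in> carrier S"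
      and eq: "inv\<^bsub>G\<^esub> (i s) \<otimes>\<^bsub>G\<^esub> i t = inv\<^bsub>G\<^esub> (i s') \<otimes>\<^bsub>G\<^esub> i t'" for s' t'
  proof -
    obtain a b where ab: "a \<in> carrier S" "b \<in> carrier S" "a \<otimes> s = b \<otimes> s'"
      using st(1) s't'(1) by (rule common_multiple)
    have at: "a \<otimes> t = b \<otimes> t'"
      using eq fraction_eq_iff[OF st s't' ab] by simp
    have "f a \<otimes> f s = f b \<otimes> f s'" "f a \<otimes> f t = f b \<otimes> f t'"
      using ab at st s't' by (simp_all flip: auto_mult[OF f])
    then show ?thesis
      using fraction_eq_iff[of "f s" "f t" "f s'" "f t'" "f a" "f b"] ab st s't'
      by (simp add: auto_closed[OF f])
  qed
  have "(THE h. \<exists>s'\<in>carrier S. \<exists>t'\<in>carrier S.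
      inv\<^bsub>G\<^esub> (i s) \<otimes>\<^bsub>G\<^esub> i t = inv\<^bsub>G\<^esub> (i s') \<otimes>\<^bsub>G\<^esub> i t' \<and> h = inv\<^bsub>G\<^esub> (i (f s')) \<otimes>\<^bsub>G\<^esub> i (f t'))
      = inv\<^bsub>G\<^esub> (i (f s)) \<otimes>\<^bsub>G\<^esub> i (f t)"
    using st * by (intro the_equality) blast+
  then show ?thesis
    using st by (simp add: extend_aut_def i_closed)
qed

lemma extend_aut_i:
  assumes "f \<in> auto S" "s \<in> carrier S"
  shows "extend_aut S G i f (i s) = i (f s)"
  using extend_aut_fraction[OF assms(1) one_closed assms(2)] assms
  by (simp add: i_one i_closed auto_one auto_closed)

lemma extend_aut_hom:
  assumes f: "f \<in> auto S"
  shows "extend_aut S G i f \<in> hom G G"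
proof (rule homI)
  note cl = i_closed auto_closed[OF f]
  fix g h assume g: "g \<in> carrier G" and h: "h \<in> carrier G"
  from g obtain s t where st: "s \<in> carrier S" "t \<in> carrier S" "g = inv\<^bsub>G\<^esub> (i s) \<otimes>\<^bsub>G\<^esub> i t"
    by (rule fraction_cases)
  show "extend_aut S G i f g \<in> carrier G"
    using st by (simp add: extend_aut_fraction f cl)
  from h obtain s' t' where st': "s' \<in> carrier S" "t' \<in> carrier S" "h = inv\<^bsub>G\<^esub> (i s') \<otimes>\<^bsub>G\<^esub> i t'"
    by (rule fraction_cases)
  obtain a b where ab: "a \<in> carrier S" "b \<in> carrier S" "a \<otimes> t = b \<otimes> s'"
    using st(2) st'(1) by (rule common_multiple)
  \<comment> \<open>Expanding so that the inner numerator and denominator agree makes them cancel. The identity is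
    used for \<open>g \<otimes> h\<close> and for its image.\<close>
  have product: "inv\<^bsub>G\<^esub> (i p) \<otimes>\<^bsub>G\<^esub> i q \<otimes>\<^bsub>G\<^esub> (inv\<^bsub>G\<^esub> (i p') \<otimes>\<^bsub>G\<^esub> i q') = inv\<^bsub>G\<^esub> (i (d \<otimes> p)) \<otimes>\<^bsub>G\<^esub> i (e \<otimes> q')"
    if "p \<in> carrier S" "q \<in> carrier S" "p' \<in> carrier S" "q' \<in> carrier S"
      "d \<in> carrier S" "e \<in> carrier S" "d \<otimes> q = e \<otimes> p'" for p q p' q' d e
  proof -
    have "inv\<^bsub>G\<^esub> (i p) \<otimes>\<^bsub>G\<^esub> i q \<otimes>\<^bsub>G\<^esub> (inv\<^bsub>G\<^esub> (i p') \<otimes>\<^bsub>G\<^esub> i q')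
        = inv\<^bsub>G\<^esub> (i (d \<otimes> p)) \<otimes>\<^bsub>G\<^esub> i (d \<otimes> q) \<otimes>\<^bsub>G\<^esub> (inv\<^bsub>G\<^esub> (i (e \<otimes> p')) \<otimes>\<^bsub>G\<^esub> i (e \<otimes> q'))"
      using that(1-6) by (simp only: fraction_mult_left)
    also have "\<dots> = inv\<^bsub>G\<^esub> (i (d \<otimes> p)) \<otimes>\<^bsub>G\<^esub> i (e \<otimes> q')"
      using that by (simp add: i_closed G.m_assoc flip: G.m_assoc[of "i (e \<otimes> p')"])
    finally show ?thesis .
  qed
  have fab: "f a \<otimes> f t = f b \<otimes> f s'"
    using ab st st' by (simp flip: auto_mult[OF f])
  have "extend_aut S G i f (g \<otimes>\<^bsub>G\<^esub> h) = inv\<^bsub>G\<^esub> (i (f (a \<otimes> s))) \<otimes>\<^bsub>G\<^esub> i (f (b \<otimes> t'))"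
    using st st' ab product[of s t s' t' a b] by (simp add: extend_aut_fraction f)
  also have "\<dots> = extend_aut S G i f g \<otimes>\<^bsub>G\<^esub> extend_aut S G i f h"
    using st st' ab fab product[of "f s" "f t" "f s'" "f t'" "f a" "f b"]
    by (simp add: extend_aut_fraction f cl auto_mult)
  finally show "extend_aut S G i f (g \<otimes>\<^bsub>G\<^esub> h) = extend_aut S G i f g \<otimes>\<^bsub>G\<^esub> extend_aut S G i f h" .
qed

text \<open>
  The image of \<open>S\<close> generates \<open>G\<close>, so homomorphisms are compared on \<open>S\<close> only. Compatibility of the
  extension with composites, identities and inner automorphisms follows.
\<close>

lemma hom_eq_on_fractions:
  assumes h: "h \<in> hom G G" and k: "k \<in> hom G G"
    and eq: "\<And>s. s \<in> carrier S \<Longrightarrow> h (i s) = k (i s)" and g: "g \<in> carrier G"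
  shows "h g = k g"
proof -
  interpret h: group_hom G G h by unfold_locales (rule h)
  interpret k: group_hom G G k by unfold_locales (rule k)
  from g obtain s t where st: "s \<in> carrier S" "t \<in> carrier S" "g = inv\<^bsub>G\<^esub> (i s) \<otimes>\<^bsub>G\<^esub> i t"
    by (rule fraction_cases)
  then show ?thesis by (simp add: i_closed eq)
qed

lemma extend_aut_compose:
  assumes f: "f \<in> auto S" and f': "f' \<in> auto S" and g: "g \<in> carrier G"
  shows "extend_aut S G i f (extend_aut S G i f' g) = extend_aut S G i (compose (carrier S) f f') g"
proof -
  have "extend_aut S G i f \<circ> extend_aut S G i f' \<in> hom G G"
    by (rule hom_compose[OF extend_aut_hom[OF f'] extend_aut_hom[OF f]])
  from hom_eq_on_fractions[OF this extend_aut_hom[OF auto_compose[OF f f']] _ g] show ?thesis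
    by (simp add: extend_aut_i f f' auto_closed auto_compose compose_eq)
qed

lemma id_auto: "(\<lambda>s \<in> carrier S. s) \<in> auto S"
  using inner_aut_auto[of \<one>] by (simp add: inner_aut_one)

lemma extend_aut_id:
  assumes "g \<in> carrier G"
  shows "extend_aut S G i (\<lambda>s \<in> carrier S. s) g = g"
proof -
  have "(\<lambda>g. g) \<in> hom G G" by (simp add: hom_def)
  from hom_eq_on_fractions[OF extend_aut_hom[OF id_auto] this _ assms] show ?thesis
    by (simp add: extend_aut_i id_auto)
qed

lemma extend_aut_auto:
  assumes f: "f \<in> auto S"
  shows "extend_aut S G i f \<in> auto G"
proof -
  obtain f' where f': "f' \<in> auto S" "compose (carrier S) f' f = (\<lambda>s \<in> carrier S. s)"
    "compose (carrier S) f f' = (\<lambda>s \<in> carrier S. s)"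
    using f by (rule auto_inverse)
  have "bij_betw (extend_aut S G i f) (carrier G) (carrier G)"
    by (rule bij_betw_byWitness[where f' = "extend_aut S G i f'"])
      (auto simp: extend_aut_compose extend_aut_id f f'
        intro: hom_in_carrier[OF extend_aut_hom])
  then show ?thesis
    using extend_aut_hom[OF f] by (simp add: auto_def Bij_def extend_aut_def)
qed

lemma extend_inner_aut:
  assumes u: "u \<in> Units S" and g: "g \<in> carrier G"
  shows "extend_aut S G i (inner_aut S u) g = inner_aut G (i u) g"
proof (rule hom_eq_on_fractions[OF _ _ _ g])
  show "extend_aut S G i (inner_aut S u) \<in> hom G G"
    by (rule extend_aut_hom[OF inner_aut_auto[OF u]])
  show "inner_aut G (i u) \<in> hom G G"
    using u by (intro G.auto_hom G.inner_aut_auto) (simp add: i_closed Units_closed)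
  show "extend_aut S G i (inner_aut S u) (i s) = inner_aut G (i u) (i s)" if "s \<in> carrier S" for s
    using that u
    by (simp add: extend_aut_i inner_aut_auto inner_aut_apply G.inner_aut_apply i_closed i_mult i_inv
        Units_closed)
qed

lemma extend_class_eq:
  assumes C: "C \<in> carrier (OutGroup S)" and f: "f \<in> C"
  shows "extend_class S G i C = aut_class G (extend_aut S G i f)"
proof -
  define h where "h = (SOME f. f \<in> C)"
  have h: "h \<in> C"
    using outer_class(1)[OF C] by (simp add: h_def some_in_eq)
  note f_auto = outer_class(2)[OF C f]
  obtain u where u: "u \<in> Units S" and eq: "h = compose (carrier S) (inner_aut S u) f"
    using outer_class(3)[OF C f] h mem_aut_class_iff[OF f_auto] by auto
  have iu: "i u \<in> Units G" using u by (simp add: i_closed Units_closed)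
  have "extend_aut S G i h = compose (carrier G) (inner_aut G (i u)) (extend_aut S G i f)"
  proof (rule extensionalityI)
    show "extend_aut S G i h g = compose (carrier G) (inner_aut G (i u)) (extend_aut S G i f) g"
      if "g \<in> carrier G" for g
      using u that
      by (simp add: eq compose_eq f_auto inner_aut_auto extend_inner_aut
          G.auto_closed[OF extend_aut_auto] flip: extend_aut_compose)
  qed (auto simp: extend_aut_def)
  then show ?thesis
    using G.aut_class_inner_compose[OF extend_aut_auto[OF f_auto] iu]
    by (simp add: extend_class_def flip: h_def)
qed

text \<open>
  Conjugation by the image of \<open>z\<close> fixes the image of \<open>S\<close>, and is therefore the identity of \<open>G\<close>.
\<close>

lemma i_centre:
  assumes z: "z \<in> centre S"
  shows "i z \<in> centre G"
proof -
  have z': "z \<in> carrier S" by (rule centre_closed[OF z])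
  have "i z \<otimes>\<^bsub>G\<^esub> g = g \<otimes>\<^bsub>G\<^esub> i z" if g: "g \<in> carrier G" for g
  proof -
    have comm: "i z \<otimes>\<^bsub>G\<^esub> i s = i s \<otimes>\<^bsub>G\<^esub> i z" if "s \<in> carrier S" for s
      using centre_commute[OF z that] z' that by (simp flip: i_mult)
    have "inner_aut G (i z) \<in> hom G G"
      using z' by (intro G.auto_hom G.inner_aut_auto) (simp add: i_closed)
    moreover have "(\<lambda>g. g) \<in> hom G G" by (simp add: hom_def)
    ultimately have "inner_aut G (i z) g = g"
      by (rule hom_eq_on_fractions[OF _ _ _ g])
        (simp add: z' i_closed G.inner_aut_apply comm G.m_assoc)
    then show ?thesis
      using G.inner_aut_mult_right[of "i z" g] g z' by (simp add: i_closed)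
  qed
  then show ?thesis using z' by (simp add: centre_def i_closed)
qed

lemma extend_twisted_action:
  assumes "twisted_action P S T c"
  shows "twisted_action P G (\<lambda>x. extend_aut S G i (T x)) (\<lambda>x y. i (c x y))"
proof -
  interpret T: twisted_action P S T c by fact
  let ?T = "\<lambda>x. extend_aut S G i (T x)"
  show ?thesis
  proof unfold_locales
    fix x y g
    assume xy: "x \<in> carrier P" "y \<in> carrier P" and g: "g \<in> carrier G"
    have xy': "x \<otimes>\<^bsub>P\<^esub> y \<in> carrier P" using xy by simp
    have "compose (carrier S) (T x) (T y)
        = compose (carrier S) (inner_aut S (c x y)) (T (x \<otimes>\<^bsub>P\<^esub> y))"
    proof
      fix s
      have "T x (T y s) = inner_aut S (c x y) (T (x \<otimes>\<^bsub>P\<^esub> y) s)" if s: "s \<in> carrier S"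
      proof (rule r_cancel[where c = "c x y"])
        show "T x (T y s) \<otimes> c x y = inner_aut S (c x y) (T (x \<otimes>\<^bsub>P\<^esub> y) s) \<otimes> c x y"
          using xy s by (simp add: T.T_T inner_aut_mult_right T.c_Units T.closed)
      qed (use xy s in \<open>simp_all add: T.closed inner_aut_apply T.c_Units\<close>)
      then show "compose (carrier S) (T x) (T y) s
          = compose (carrier S) (inner_aut S (c x y)) (T (x \<otimes>\<^bsub>P\<^esub> y)) s"
        by (simp add: compose_def)
    qed
    then have "?T x (?T y g) = inner_aut G (i (c x y)) (?T (x \<otimes>\<^bsub>P\<^esub> y) g)"
      using xy xy' g
      by (simp add: extend_aut_compose T.T_auto)
        (simp add: T.T_auto T.c_Units inner_aut_auto extend_inner_aut
          G.auto_closed[OF extend_aut_auto] flip: extend_aut_compose)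
    then show "?T x (?T y g) \<otimes>\<^bsub>G\<^esub> i (c x y) = i (c x y) \<otimes>\<^bsub>G\<^esub> ?T (x \<otimes>\<^bsub>P\<^esub> y) g"
      using xy g
      by (simp add: G.inner_aut_mult_right i_closed T.closed G.auto_closed[OF extend_aut_auto]
          T.T_auto)
  next
    have "T \<one>\<^bsub>P\<^esub> = (\<lambda>s \<in> carrier S. s)"
      using T.T_one by (intro extensionalityI[OF auto_extensional[OF T.T_auto]]) auto
    then show "?T \<one>\<^bsub>P\<^esub> g = g" if "g \<in> carrier G" for g
      using that by (simp add: extend_aut_id)
  qed (simp_all add: T.T_auto extend_aut_auto i_closed T.closed T.c_one i_one)
qed

lemma extend_obstruction:
  assumes "twisted_action P S T c" and "x \<in> carrier P" "y \<in> carrier P" "z \<in> carrier P"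
  shows "twisted_action.obstruction P G (\<lambda>x. extend_aut S G i (T x)) (\<lambda>x y. i (c x y)) x y z
    = i (twisted_action.obstruction P S T c x y z)"
proof -
  interpret T: twisted_action P S T c by fact
  interpret TG: twisted_action P G "\<lambda>x. extend_aut S G i (T x)" "\<lambda>x y. i (c x y)"
    by (rule extend_twisted_action) fact
  show ?thesis
    using assms(2-)
    by (simp add: TG.obstruction_def T.obstruction_def extend_aut_i T.T_auto T.closed i_mult i_inv
        T.c_Units)
qed

end


section \<open>Vanishing cohomology\<close>

text \<open>
  In a one-element quotient the classes of \<open>f\<close> and of the zero cocycle coincide. The zero cocycle
  lies in its own class, hence in that of \<open>f\<close>, which says that the two are related.
\<close>

lemma cobounding_cochains:
  assumes "Pi_semimodule P A act" and "is_singleton (carrier (H3 P A act))"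
    and f: "f \<in> cocycles3 P A act"
  obtains g1 g2 where "g1 \<in> cochains2 P A" "g2 \<in> cochains2 P A"
    "\<And>x y z. \<lbrakk>x \<in> carrier P; y \<in> carrier P; z \<in> carrier P\<rbrakk> \<Longrightarrow>
      f (x, y, z) \<otimes>\<^bsub>A\<^esub> g1 (x \<otimes>\<^bsub>P\<^esub> y, z) \<otimes>\<^bsub>A\<^esub> g1 (x, y)
          \<otimes>\<^bsub>A\<^esub> act x (g2 (y, z)) \<otimes>\<^bsub>A\<^esub> g2 (x, y \<otimes>\<^bsub>P\<^esub> z)
      = g2 (x \<otimes>\<^bsub>P\<^esub> y, z) \<otimes>\<^bsub>A\<^esub> g2 (x, y) \<otimes>\<^bsub>A\<^esub> act x (g1 (y, z)) \<otimes>\<^bsub>A\<^esub> g1 (x, y \<otimes>\<^bsub>P\<^esub> z)"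
proof -
  interpret Pi_semimodule P A act by fact
  let ?R = "cohomologous3 P A act"
  define o3 where "o3 = zero_cochain3 P A"
  define o2 where "o2 = (\<lambda>t \<in> carrier P \<times> carrier P. \<one>\<^bsub>A\<^esub>)"
  have o3: "o3 \<in> cocycles3 P A act"
    by (auto simp: o3_def zero_cochain3_def cocycles3_def act_zero)
  have "o2 \<in> cochains2 P A"
    by (auto simp: o2_def cochains2_def)
  then have "(o3, o3) \<in> ?R"
    using o3 by (auto simp: cohomologous3_def o2_def intro!: bexI[of _ o2])
  moreover have "?R `` {f} = ?R `` {o3}"
  proof -
    obtain C where "cocycles3 P A act // ?R = {C}"
      using assms(2) by (auto simp: is_singleton_def H3_def)
    then show ?thesis
      using quotientI[OF f, of ?R] quotientI[OF o3, of ?R] by simp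
  qed
  ultimately have "(f, o3) \<in> ?R" by blast
  then obtain g1 g2 where g: "g1 \<in> cochains2 P A" "g2 \<in> cochains2 P A"
    and eq: "\<forall>x \<in> carrier P. \<forall>y \<in> carrier P. \<forall>z \<in> carrier P.
        f (x, y, z) \<otimes>\<^bsub>A\<^esub> g1 (x \<otimes>\<^bsub>P\<^esub> y, z) \<otimes>\<^bsub>A\<^esub> g1 (x, y)
          \<otimes>\<^bsub>A\<^esub> act x (g2 (y, z)) \<otimes>\<^bsub>A\<^esub> g2 (x, y \<otimes>\<^bsub>P\<^esub> z)
        = o3 (x, y, z) \<otimes>\<^bsub>A\<^esub> g2 (x \<otimes>\<^bsub>P\<^esub> y, z) \<otimes>\<^bsub>A\<^esub> g2 (x, y)
          \<otimes>\<^bsub>A\<^esub> act x (g1 (y, z)) \<otimes>\<^bsub>A\<^esub> g1 (x, y \<otimes>\<^bsub>P\<^esub> z)"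
    unfolding cohomologous3_def by blast
  have "g2 t \<in> carrier A" if "t \<in> carrier P \<times> carrier P" for t
    using g(2) that by (auto simp: cochains2_def)
  with eq show thesis
    by (intro that[OF g]) (simp add: o3_def zero_cochain3_def)
qed

text \<open>
  Inner automorphisms fix the centre, so any representative computes the action on it, in particular
  the identity, which is the lift chosen over the neutral element.
\<close>

lemma (in monoid) centre_act_eq:
  assumes C: "\<phi> x \<in> carrier (OutGroup G)" and f: "f \<in> \<phi> x" and z: "z \<in> centre G"
  shows "centre_act \<phi> x z = f z"
proof -
  define h where "h = (SOME f. f \<in> \<phi> x)"
  have h: "h \<in> \<phi> x"
    using outer_class(1)[OF C] by (simp add: h_def some_in_eq)
  note f_auto = outer_class(2)[OF C f]
  obtain u where "u \<in> Units G" "h = compose (carrier G) (inner_aut G u) f"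
    using outer_class(3)[OF C f] h mem_aut_class_iff[OF f_auto] by auto
  then show ?thesis
    using z by (simp add: centre_act_def compose_eq centre_closed inner_aut_centre
        auto_centre[OF f_auto] flip: h_def)
qed

text \<open>
  The obstruction is carried back along \<open>h\<close> to a cocycle with values in \<open>A\<close>, where the vanishing
  hypothesis applies, and the resulting cochains are carried forward to the centre of \<open>S\<close>.
\<close>

lemma (in twisted_action) obstruction_cobounds:
  assumes semimodule: "Pi_semimodule P A act" and H3: "is_singleton (carrier (H3 P A act))"
    and h: "h \<in> iso A (centre_monoid S)"
    and h_act: "\<And>x a. \<lbrakk>x \<in> carrier P; a \<in> carrier A\<rbrakk> \<Longrightarrow> h (act x a) = T x (h a)"
  obtains m n where
    "\<And>x y. \<lbrakk>x \<in> carrier P; y \<in> carrier P\<rbrakk> \<Longrightarrow> m x y \<in> centre S"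
    "\<And>x y. \<lbrakk>x \<in> carrier P; y \<in> carrier P\<rbrakk> \<Longrightarrow> n x y \<in> centre S"
    "\<And>x. x \<in> carrier P \<Longrightarrow> m \<one>\<^bsub>P\<^esub> x = \<one> \<and> m x \<one>\<^bsub>P\<^esub> = \<one> \<and> n \<one>\<^bsub>P\<^esub> x = \<one> \<and> n x \<one>\<^bsub>P\<^esub> = \<one>"
    "\<And>x y z. \<lbrakk>x \<in> carrier P; y \<in> carrier P; z \<in> carrier P\<rbrakk> \<Longrightarrow>
      obstruction x y z \<otimes> m (x \<otimes>\<^bsub>P\<^esub> y) z \<otimes> m x y \<otimes> T x (n y z) \<otimes> n x (y \<otimes>\<^bsub>P\<^esub> z)
      = n (x \<otimes>\<^bsub>P\<^esub> y) z \<otimes> n x y \<otimes> T x (m y z) \<otimes> m x (y \<otimes>\<^bsub>P\<^esub> z)"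
proof -
  interpret A: Pi_semimodule P A act by (rule semimodule)
  have h_mult: "h (a \<otimes>\<^bsub>A\<^esub> b) = h a \<otimes> h b" if "a \<in> carrier A" "b \<in> carrier A" for a b
    using h that by (auto simp: iso_def hom_def centre_monoid_def)
  have h_centre: "h a \<in> centre S" if "a \<in> carrier A" for a
    using h that by (auto simp: iso_def hom_def centre_monoid_def)
  have inj: "inj_on h (carrier A)" and surj: "h ` carrier A = centre S"
    using h by (auto simp: iso_def bij_betw_def centre_monoid_def)
  have h_one: "h \<one>\<^bsub>A\<^esub> = \<one>"
  proof (rule l_cancel)
    show "h \<one>\<^bsub>A\<^esub> \<otimes> h \<one>\<^bsub>A\<^esub> = h \<one>\<^bsub>A\<^esub> \<otimes> \<one>"
      using h_mult[of "\<one>\<^bsub>A\<^esub>" "\<one>\<^bsub>A\<^esub>"] h_centre[of "\<one>\<^bsub>A\<^esub>"] by (simp add: centre_closed)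
  qed (simp_all add: centre_closed h_centre)
  define f where "f = (\<lambda>(x, y, z) \<in> carrier P \<times> carrier P \<times> carrier P.
    inv_into (carrier A) h (obstruction x y z))"
  have f_closed: "f (x, y, z) \<in> carrier A" and h_f: "h (f (x, y, z)) = obstruction x y z"
    if "x \<in> carrier P" "y \<in> carrier P" "z \<in> carrier P" for x y z
    using obstruction_centre[OF that] that surj
    by (auto simp: f_def inv_into_into f_inv_into_f)
  note h_simps = h_mult h_one h_act h_f f_closed A.act_closed
  have "f \<in> cocycles3 P A act"
    unfolding cocycles3_def
  proof (intro CollectI conjI ballI)
    show "f \<in> carrier P \<times> carrier P \<times> carrier P \<rightarrow>\<^sub>E carrier A"
      using f_closed by (auto simp: f_def)
  next
    fix x y assume xy: "x \<in> carrier P" "y \<in> carrier P"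
    show "f (\<one>\<^bsub>P\<^esub>, x, y) = \<one>\<^bsub>A\<^esub>" "f (x, \<one>\<^bsub>P\<^esub>, y) = \<one>\<^bsub>A\<^esub>" "f (x, y, \<one>\<^bsub>P\<^esub>) = \<one>\<^bsub>A\<^esub>"
      using xy by - (rule inj_onD[OF inj]; simp add: h_simps obstruction_one)+
  next
    fix x y z t assume "x \<in> carrier P" "y \<in> carrier P" "z \<in> carrier P" "t \<in> carrier P"
    then show "act x (f (y, z, t)) \<otimes>\<^bsub>A\<^esub> f (x, y \<otimes>\<^bsub>P\<^esub> z, t) \<otimes>\<^bsub>A\<^esub> f (x, y, z)
        = f (x \<otimes>\<^bsub>P\<^esub> y, z, t) \<otimes>\<^bsub>A\<^esub> f (x, y, z \<otimes>\<^bsub>P\<^esub> t)"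
      by - (rule inj_onD[OF inj]; simp add: h_simps obstruction_cocycle)
  qed
  from cobounding_cochains[OF semimodule H3 this]
  obtain g1 g2 where g: "g1 \<in> cochains2 P A" "g2 \<in> cochains2 P A"
    and eq: "\<And>x y z. \<lbrakk>x \<in> carrier P; y \<in> carrier P; z \<in> carrier P\<rbrakk> \<Longrightarrow>
      f (x, y, z) \<otimes>\<^bsub>A\<^esub> g1 (x \<otimes>\<^bsub>P\<^esub> y, z) \<otimes>\<^bsub>A\<^esub> g1 (x, y)
          \<otimes>\<^bsub>A\<^esub> act x (g2 (y, z)) \<otimes>\<^bsub>A\<^esub> g2 (x, y \<otimes>\<^bsub>P\<^esub> z)
      = g2 (x \<otimes>\<^bsub>P\<^esub> y, z) \<otimes>\<^bsub>A\<^esub> g2 (x, y) \<otimes>\<^bsub>A\<^esub> act x (g1 (y, z)) \<otimes>\<^bsub>A\<^esub> g1 (x, y \<otimes>\<^bsub>P\<^esub> z)"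
    by blast
  have g_closed: "g1 (x, y) \<in> carrier A" "g2 (x, y) \<in> carrier A"
    if "x \<in> carrier P" "y \<in> carrier P" for x y
    using g that by (auto simp: cochains2_def)
  show thesis
  proof (rule that[of "\<lambda>x y. h (g1 (x, y))" "\<lambda>x y. h (g2 (x, y))"])
    fix x y z assume P: "x \<in> carrier P" "y \<in> carrier P" "z \<in> carrier P"
    show "obstruction x y z \<otimes> h (g1 (x \<otimes>\<^bsub>P\<^esub> y, z)) \<otimes> h (g1 (x, y)) \<otimes> T x (h (g2 (y, z)))
        \<otimes> h (g2 (x, y \<otimes>\<^bsub>P\<^esub> z))
      = h (g2 (x \<otimes>\<^bsub>P\<^esub> y, z)) \<otimes> h (g2 (x, y)) \<otimes> T x (h (g1 (y, z))) \<otimes> h (g1 (x, y \<otimes>\<^bsub>P\<^esub> z))"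
      using arg_cong[OF eq[OF P], of h] P by (simp add: h_simps g_closed)
  qed (use g in \<open>auto simp: h_centre g_closed h_one cochains2_def\<close>)
qed


section \<open>Existence of the extension\<close>

text \<open>
  Here the passage to fractions pays off: with \<open>k x y\<close> the quotient of \<open>n x y\<close> by \<open>m x y\<close>, the
  two-sided identity for \<open>m\<close> and \<open>n\<close> becomes the coboundary equation for \<open>k\<close>.
\<close>

lemma (in left_fractions) factor_set_exists:
  assumes T: "twisted_action P S T c"
    and m: "\<And>x y. \<lbrakk>x \<in> carrier P; y \<in> carrier P\<rbrakk> \<Longrightarrow> m x y \<in> centre S"
    and n: "\<And>x y. \<lbrakk>x \<in> carrier P; y \<in> carrier P\<rbrakk> \<Longrightarrow> n x y \<in> centre S"
    and mn_one: "\<And>x. x \<in> carrier P \<Longrightarrow>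
      m \<one>\<^bsub>P\<^esub> x = \<one> \<and> m x \<one>\<^bsub>P\<^esub> = \<one> \<and> n \<one>\<^bsub>P\<^esub> x = \<one> \<and> n x \<one>\<^bsub>P\<^esub> = \<one>"
    and mn: "\<And>x y z. \<lbrakk>x \<in> carrier P; y \<in> carrier P; z \<in> carrier P\<rbrakk> \<Longrightarrow>
      twisted_action.obstruction P S T c x y z
        \<otimes> m (x \<otimes>\<^bsub>P\<^esub> y) z \<otimes> m x y \<otimes> T x (n y z) \<otimes> n x (y \<otimes>\<^bsub>P\<^esub> z)
      = n (x \<otimes>\<^bsub>P\<^esub> y) z \<otimes> n x y \<otimes> T x (m y z) \<otimes> m x (y \<otimes>\<^bsub>P\<^esub> z)"
  shows "factor_set P G (\<lambda>x. extend_aut S G i (T x))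
    (\<lambda>x y. i (c x y) \<otimes>\<^bsub>G\<^esub> (i (n x y) \<otimes>\<^bsub>G\<^esub> inv\<^bsub>G\<^esub> i (m x y)))"
proof -
  interpret T: twisted_action P S T c by (rule T)
  interpret TG: twisted_action P G "\<lambda>x. extend_aut S G i (T x)" "\<lambda>x y. i (c x y)"
    by (rule extend_twisted_action[OF T])
  interpret Z: comm_monoid_cancel "centre_monoid G"
    by (rule G.centre_comm_monoid_cancel)
  have Z_carrier: "carrier (centre_monoid G) = centre G" and Z_mult: "mult (centre_monoid G) = mult G"
    by (simp_all add: centre_monoid_def)
  define k where "k x y = i (n x y) \<otimes>\<^bsub>G\<^esub> inv\<^bsub>G\<^esub> i (m x y)" for x y
  note centres = i_centre[OF m] i_centre[OF n]
  note i_mn_closed = centres[THEN G.centre_closed]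
  have k: "k x y \<in> centre G" if "x \<in> carrier P" "y \<in> carrier P" for x y
    using Z.m_closed[unfolded Z_carrier Z_mult] that by (simp add: k_def centres G.inv_centre)
  have n_eq: "i (n x y) = k x y \<otimes>\<^bsub>G\<^esub> i (m x y)" if "x \<in> carrier P" "y \<in> carrier P" for x y
    using that by (simp add: k_def G.m_assoc i_mn_closed)
  have k_obstruction: "TG.obstruction x y z \<otimes>\<^bsub>G\<^esub> extend_aut S G i (T x) (k y z) \<otimes>\<^bsub>G\<^esub> k x (y \<otimes>\<^bsub>P\<^esub> z)
      = k (x \<otimes>\<^bsub>P\<^esub> y) z \<otimes>\<^bsub>G\<^esub> k x y"
    if P: "x \<in> carrier P" "y \<in> carrier P" "z \<in> carrier P" for x y z
  proof (rule Z.cancel_common_terms[unfolded Z_carrier Z_mult])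
    let ?T = "\<lambda>x. extend_aut S G i (T x)"
    let ?mn = "\<lambda>x y. x \<otimes>\<^bsub>P\<^esub> y"
    note T_k = TG.T_mult[OF _ G.centre_closed[OF k] i_mn_closed(1)]
    have "i (T.obstruction x y z \<otimes> m (?mn x y) z \<otimes> m x y \<otimes> T x (n y z) \<otimes> n x (?mn y z))
        = i (n (?mn x y) z \<otimes> n x y \<otimes> T x (m y z) \<otimes> m x (?mn y z))"
      by (simp add: mn P)
    then have "TG.obstruction x y z \<otimes>\<^bsub>G\<^esub> i (m (?mn x y) z) \<otimes>\<^bsub>G\<^esub> i (m x y)
        \<otimes>\<^bsub>G\<^esub> ?T x (i (n y z)) \<otimes>\<^bsub>G\<^esub> i (n x (?mn y z))
      = i (n (?mn x y) z) \<otimes>\<^bsub>G\<^esub> i (n x y) \<otimes>\<^bsub>G\<^esub> ?T x (i (m y z)) \<otimes>\<^bsub>G\<^esub> i (m x (?mn y z))"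
      using P
      by (simp add: extend_obstruction[OF T] i_mult extend_aut_i T.T_auto T.T_closed
          T.obstruction_closed centre_closed[OF m] centre_closed[OF n])
    then show "TG.obstruction x y z \<otimes>\<^bsub>G\<^esub> i (m (?mn x y) z) \<otimes>\<^bsub>G\<^esub> i (m x y)
        \<otimes>\<^bsub>G\<^esub> (?T x (k y z) \<otimes>\<^bsub>G\<^esub> ?T x (i (m y z))) \<otimes>\<^bsub>G\<^esub> (k x (?mn y z) \<otimes>\<^bsub>G\<^esub> i (m x (?mn y z)))
      = (k (?mn x y) z \<otimes>\<^bsub>G\<^esub> i (m (?mn x y) z)) \<otimes>\<^bsub>G\<^esub> (k x y \<otimes>\<^bsub>G\<^esub> i (m x y))
        \<otimes>\<^bsub>G\<^esub> ?T x (i (m y z)) \<otimes>\<^bsub>G\<^esub> i (m x (?mn y z))"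
      using P by (simp add: n_eq T_k)
  qed (simp_all add: P k centres TG.obstruction_centre G.auto_centre[OF TG.T_auto])
  have "factor_set P G (\<lambda>x. extend_aut S G i (T x)) (\<lambda>x y. i (c x y) \<otimes>\<^bsub>G\<^esub> k x y)"
    by (rule TG.factor_set_of_trivial_obstruction[OF G.is_group k])
      (simp_all add: k_def mn_one i_one k_obstruction[unfolded k_def])
  then show ?thesis by (simp add: k_def)
qed

theorem corollary5p4:
  fixes P :: "('p, 'pm) monoid_scheme"
    and A :: "('a, 'am) monoid_scheme"
    and act :: "'p \<Rightarrow> 'a \<Rightarrow> 'a"
    and S :: "('s, 'sm) monoid_scheme"
    and \<phi> :: "'p \<Rightarrow> ('s \<Rightarrow> 's) set"
    and G :: "('g, 'gm) monoid_scheme"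
    and i :: "'s \<Rightarrow> 'g"
  assumes "group P"
    and "Pi_semimodule P A act" and "comm_monoid_cancel A"
    and "is_singleton (carrier (H3 P A act))"
    and "Ore_monoid S"
    and "\<phi> \<in> hom P (OutGroup S)"
    and "semimodules_isomorphic P A act (centre_monoid S) (centre_act \<phi>)"
    and "left_fraction_group S G i"
  shows "kernel_has_extension P G (extend_class S G i \<circ> \<phi>)"
proof -
  interpret Ore_monoid S by fact
  interpret left_fractions S G i
    using \<open>left_fraction_group S G i\<close>
    by (intro left_fractions.intro left_fractions_axioms.intro Ore_monoid_axioms)
      (simp_all add: left_fraction_group_def)
  obtain T c where T: "twisted_action P S T c" and T_mem: "\<And>x. x \<in> carrier P \<Longrightarrow> T x \<in> \<phi> x"
    using twisted_action_exists[OF \<open>group P\<close> is_monoid_cancel \<open>\<phi> \<in> hom P (OutGroup S)\<close>] by blast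
  interpret T: twisted_action P S T c by (rule T)
  have \<phi>: "\<phi> x \<in> carrier (OutGroup S)" if "x \<in> carrier P" for x
    using \<open>\<phi> \<in> hom P (OutGroup S)\<close> that by (rule hom_in_carrier)
  obtain h where h: "h \<in> iso A (centre_monoid S)"
    and h_act: "\<forall>x \<in> carrier P. \<forall>a \<in> carrier A. h (act x a) = centre_act \<phi> x (h a)"
    using \<open>semimodules_isomorphic P A act (centre_monoid S) (centre_act \<phi>)\<close>
    unfolding semimodules_isomorphic_def by blast
  have h_T: "h (act x a) = T x (h a)" if "x \<in> carrier P" "a \<in> carrier A" for x a
  proof -
    have "h a \<in> centre S"
      using h that(2) by (auto simp: iso_def hom_def centre_monoid_def)
    then show ?thesis
      using that h_act centre_act_eq[where \<phi> = \<phi>, OF \<phi> T_mem] by simp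
  qed
  note cobounds = T.obstruction_cobounds[OF \<open>Pi_semimodule P A act\<close>
      \<open>is_singleton (carrier (H3 P A act))\<close> h h_T]
  obtain c' where "factor_set P G (\<lambda>x. extend_aut S G i (T x)) c'"
    by (rule cobounds, assumption+) (rule that, rule factor_set_exists[OF T])
  then interpret factor_set P G "\<lambda>x. extend_aut S G i (T x)" c' .
  have "(extend_class S G i \<circ> \<phi>) x = aut_class G (extend_aut S G i (T x))" if "x \<in> carrier P" for x
    using extend_class_eq[OF \<phi> T_mem] that by simp
  from kernel_has_extensionI[OF crossed_product_extension crossed_product_induces[OF this]]
  show ?thesis .
qed

end
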